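(* Let $\mathcal M$ be a finite-dimensional von Neumann algebra with faithful trace $\tau$, and let $\mathcal N\subset\mathcal M$ be a von Neumann subalgebra. Then for all faithful states $\rho,\sigma$ on $\mathcal M$ and all $t\in\mathbb R$ the following inequalities hold: \begin{align*} D(\rho\|\sigma)-D(\rho_{\mathcal N}\|\sigma_{\mathcal N}) &\ge \left(\frac{\pi}{8}\right)^4 Q_{x^2}(\rho\|\sigma)^{-1}\,\|\sigma-R_\rho(\sigma_{\mathcal N})\|_1^4,\\ D(\rho\|\sigma)-D(\rho_{\mathcal N}\|\sigma_{\mathcal N}) &\ge \left(\frac{\pi}{8\cosh(\pi t)}\right)^4 Q_{x^2}(\rho\|\sigma)^{-1}\,\|\sigma-R^t_\rho(\sigma_{\mathcal N})\|_1^4,\\ D(\rho\|\sigma)-D(\rho_{\mathcal N}\|\sigma_{\mathcal N}) &\ge \frac{1}{256}\, Q_{x^2}(\rho\|\sigma)^{-1}\,\|\sigma-R^u_\rho(\sigma_{\mathcal N})\|_1^4, \end{align*} where $Q_{x^2}(\rho\|\sigma)=\tau(\rho^{-1}\sigma^2)$.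
   Context: $\mathcal M$ is a finite-dimensional von Neumann algebra with faithful trace $\tau$; $\mathcal N\subset\mathcal M$ is a von Neumann subalgebra containing the identity, and $E:\mathcal M\to\mathcal N$ is the trace-preserving conditional expectation ($\tau(xy)=\tau(xE(y))$ for $x\in\mathcal N$, $y\in\mathcal M$). A state is a density operator $\rho\ge0$ with $\tau(\rho)=1$; faithful means invertible. $\rho_{\mathcal N}:=E(\rho)$, $\sigma_{\mathcal N}:=E(\sigma)$. $\|x\|_1=\tau(|x|)$. $D(\rho\|\sigma)=\tau(\rho\log\rho-\rho\log\sigma)$. For faithful $\rho$ and $t\in\mathbb R$, the rotated Petz map is $R^t_\rho(x)=\rho^{\frac12-it}\rho_{\mathcal N}^{-\frac12+it}\,x\,\rho_{\mathcal N}^{-\frac12-it}\rho^{\frac12+it}$ for $x\in\mathcal N$; the Petz map is $R_\rho:=R^0_\rho$; the universal Petz map is $R^u_\rho(x)=\int_{\mathbb R}R_\rho^{t/2}(x)\,d\beta(t)$ with $d\beta(t)=\frac{\pi}{2}(\cosh(\pi t)+1)^{-1}dt$. *)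

theory Defs
  imports "HOL-Analysis.Analysis"
begin

type_synonym 'n cmat = "complex^'n^'n"

definition adj :: "'n::finite cmat \<Rightarrow> 'n cmat" where
  "adj A = (\<chi> i j. cnj (A $ j $ i))"

definition cscale :: "complex \<Rightarrow> 'n::finite cmat \<Rightarrow> 'n cmat" where
  "cscale c A = (\<chi> i j. c * A $ i $ j)"

definition unitary_mat :: "'n::finite cmat \<Rightarrow> bool" where
  "unitary_mat U \<longleftrightarrow> adj U ** U = mat 1 \<and> U ** adj U = mat 1"

definition diag_mat :: "('n::finite \<Rightarrow> complex) \<Rightarrow> 'n cmat" where
  "diag_mat d = (\<chi> i j. if i = j then d i else 0)"

definition hermitian :: "'n::finite cmat \<Rightarrow> bool" where
  "hermitian A \<longleftrightarrow> adj A = A"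

definition psd :: "'n::finite cmat \<Rightarrow> bool" where
  "psd A \<longleftrightarrow> hermitian A \<and> (\<forall>v::complex^'n. 0 \<le> Re (\<Sum>i\<in>UNIV. cnj (v $ i) * (A *v v) $ i))"

definition matfun :: "(real \<Rightarrow> complex) \<Rightarrow> 'n::finite cmat \<Rightarrow> 'n cmat" where
  "matfun f A = (SOME B. \<exists>U d. unitary_mat U \<and>
       A = U ** diag_mat (\<lambda>i. complex_of_real (d i)) ** adj U \<and>
       B = U ** diag_mat (\<lambda>i. f (d i)) ** adj U)"

definition mpow :: "'n::finite cmat \<Rightarrow> complex \<Rightarrow> 'n cmat" where
  "mpow A z = matfun (\<lambda>s. complex_of_real s powr z) A"

definition mlog :: "'n::finite cmat \<Rightarrow> 'n cmat" where
  "mlog A = matfun (\<lambda>s. complex_of_real (ln s)) A"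

definition mabs :: "'n::finite cmat \<Rightarrow> 'n cmat" where
  "mabs A = matfun (\<lambda>s. complex_of_real (sqrt s)) (adj A ** A)"

text \<open>A unital *-subalgebra of M_n(C) (every finite-dimensional von Neumann algebra
  is of this form).\<close>
definition star_subalg :: "'n::finite cmat set \<Rightarrow> bool" where
  "star_subalg M \<longleftrightarrow> mat 1 \<in> M \<and> (\<forall>x\<in>M. \<forall>y\<in>M. x + y \<in> M \<and> x ** y \<in> M)
     \<and> (\<forall>x\<in>M. \<forall>c. cscale c x \<in> M) \<and> (\<forall>x\<in>M. adj x \<in> M)"

definition faithful_trace :: "'n::finite cmat set \<Rightarrow> ('n cmat \<Rightarrow> complex) \<Rightarrow> bool" where
  "faithful_trace M tau \<longleftrightarrow>
     (\<forall>x\<in>M. \<forall>y\<in>M. tau (x + y) = tau x + tau y) \<and>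
     (\<forall>x\<in>M. \<forall>c. tau (cscale c x) = c * tau x) \<and>
     (\<forall>x\<in>M. \<forall>y\<in>M. tau (x ** y) = tau (y ** x)) \<and>
     (\<forall>x\<in>M. psd x \<longrightarrow> Im (tau x) = 0 \<and> Re (tau x) \<ge> 0) \<and>
     (\<forall>x\<in>M. psd x \<and> x \<noteq> 0 \<longrightarrow> Re (tau x) > 0)"

definition cond_exp :: "'n::finite cmat set \<Rightarrow> 'n cmat set \<Rightarrow> ('n cmat \<Rightarrow> complex)
    \<Rightarrow> ('n cmat \<Rightarrow> 'n cmat) \<Rightarrow> bool" where
  "cond_exp M N tau E \<longleftrightarrow> (\<forall>y\<in>M. E y \<in> N) \<and>
     (\<forall>x\<in>N. \<forall>y\<in>M. tau (x ** y) = tau (x ** E y))"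

definition is_state :: "'n::finite cmat set \<Rightarrow> ('n cmat \<Rightarrow> complex) \<Rightarrow> 'n cmat \<Rightarrow> bool" where
  "is_state M tau \<rho> \<longleftrightarrow> \<rho> \<in> M \<and> psd \<rho> \<and> tau \<rho> = 1"

definition faithful_state :: "'n::finite cmat set \<Rightarrow> ('n cmat \<Rightarrow> complex) \<Rightarrow> 'n cmat \<Rightarrow> bool" where
  "faithful_state M tau \<rho> \<longleftrightarrow> is_state M tau \<rho> \<and> invertible \<rho>"

definition rel_ent :: "('n::finite cmat \<Rightarrow> complex) \<Rightarrow> 'n cmat \<Rightarrow> 'n cmat \<Rightarrow> real" where
  "rel_ent tau \<rho> \<sigma> = Re (tau (\<rho> ** mlog \<rho> - \<rho> ** mlog \<sigma>))"

definition norm1 :: "('n::finite cmat \<Rightarrow> complex) \<Rightarrow> 'n cmat \<Rightarrow> real" where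
  "norm1 tau x = Re (tau (mabs x))"

definition Qx2 :: "('n::finite cmat \<Rightarrow> complex) \<Rightarrow> 'n cmat \<Rightarrow> 'n cmat \<Rightarrow> real" where
  "Qx2 tau \<rho> \<sigma> = Re (tau (matrix_inv \<rho> ** \<sigma> ** \<sigma>))"

definition petz_rot :: "('n::finite cmat \<Rightarrow> 'n cmat) \<Rightarrow> 'n cmat \<Rightarrow> real \<Rightarrow> 'n cmat \<Rightarrow> 'n cmat" where
  "petz_rot E \<rho> t x =
     mpow \<rho> (1/2 - \<i> * of_real t) ** mpow (E \<rho>) (-1/2 + \<i> * of_real t) ** x
       ** mpow (E \<rho>) (-1/2 - \<i> * of_real t) ** mpow \<rho> (1/2 + \<i> * of_real t)"

definition petz :: "('n::finite cmat \<Rightarrow> 'n cmat) \<Rightarrow> 'n cmat \<Rightarrow> 'n cmat \<Rightarrow> 'n cmat" where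
  "petz E \<rho> x = petz_rot E \<rho> 0 x"

definition beta_dens :: "real \<Rightarrow> real" where
  "beta_dens t = (pi / 2) / (cosh (pi * t) + 1)"

definition petz_univ :: "('n::finite cmat \<Rightarrow> 'n cmat) \<Rightarrow> 'n cmat \<Rightarrow> 'n cmat \<Rightarrow> 'n cmat" where
  "petz_univ E \<rho> x = (\<integral>t. beta_dens t *\<^sub>R petz_rot E \<rho> (t/2) x \<partial>lborel)"

end

(*
  Write w_s for the difference of the resolvents (s + Delta)^{-1} 1 of the relative modular operators of
  the pair (sigma, rho) in M and of the pair (E sigma, E rho) in N, in the GNS space of rho.  Since
  -ln a is the integral over s of 1/(s + a) - 1/(s + 1), the entropy difference is the integral over s
  of the nonnegative gap <1, (s + Delta)^{-1} 1> - <1, (s + Delta_N)^{-1} 1>, and this gap is at least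
  s |w_s|^2.  Let z = 1/2 + i t.  Up to the factor cosh(pi t) / pi, the vector
  W = Delta^z 1 - Delta_N^z 1 is the integral over s of -s^z w_s; Cauchy-Schwarz on (0, T), the a priori
  bound |w_s| <= 2 sqrt Q / s^2 on (T, oo), and optimisation over T bound |W| by the entropy difference.
  Finally sigma = X* X and the rotated Petz image of E sigma is Y* Y with X = sigma^z and
  Y = (E sigma)^z (E rho)^{-z} rho^z, and the 2-norm of X - Y is |W|.  The universal map follows by
  averaging over t.
*)

theory Submission
  imports Defs "HOL-Real_Asymp.Real_Asymp"
begin

text \<open>In finite dimension a function of Delta applied to the identity is a finite double sum
  over \<open>spec \<sigma>\<close> and \<open>spec \<rho>\<close>, so operator integrals reduce to
  scalar ones in the ratio \<open>q / p\<close>. The gap dominates s |w_s|^2 because the GNS space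
  of \<open>E \<rho>\<close> sits isometrically in that of \<open>\<rho>\<close> and the forms of
  the two modular operators agree on it: the resolvent vector of N is the Galerkin approximation in
  N of the one of M. The obstacle is large s. The gap bounds sqrt(s) |w_s| only by the root of an
  integrable function, so (0, T) contributes sqrt(T D) with D the entropy difference, which grows
  with T. The tail is paid for by the second moment Q = |Delta 1|^2. Balancing sqrt(T D) against 4
  sqrt(Q / T) gives 4 (Q D)^(1/4), hence the fourth powers. Splitting the difference of squares
  doubles this, hence 8 cosh(pi t) / pi; the beta-mean of cosh(pi t / 2) is pi / 2, which turns 8 /
  pi into 4 = 256^(1/4). The trace norm is reached through the scalars tau(S x) with S unitary,
  which commute with the averaging over t.\<close>

lemma adj_nth [simp]: "adj A $ i $ j = cnj (A $ j $ i)"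
  by (simp add: adj_def)

lemma cscale_nth [simp]: "cscale c A $ i $ j = c * A $ i $ j"
  by (simp add: cscale_def)

lemma cmat_eqI: "(\<And>i j. A $ i $ j = B $ i $ j) \<Longrightarrow> A = (B::'n::finite cmat)"
  by (simp add: vec_eq_iff)

lemma matmul_nth: "(A ** B) $ i $ j = (\<Sum>k\<in>UNIV. A $ i $ k * B $ k $ j)"
  by (simp add: matrix_matrix_mult_def)

lemma adj_adj [simp]: "adj (adj A) = A"
  and adj_add: "adj (A + B) = adj A + adj B"
  and adj_diff: "adj (A - B) = adj A - adj B"
  and adj_zero [simp]: "adj 0 = (0::'n::finite cmat)"
  and adj_cscale: "adj (cscale c A) = cscale (cnj c) (adj A)"
  and adj_scaleR: "adj (r *\<^sub>R A) = r *\<^sub>R adj A"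
  for A B :: "'n::finite cmat"
  by (auto intro!: cmat_eqI)

lemma adj_mult: "adj (A ** B) = adj B ** adj A"
  by (intro cmat_eqI) (simp add: matmul_nth mult.commute)

lemma adj_mat_1 [simp]: "adj (mat 1 :: 'n::finite cmat) = mat 1"
  by (intro cmat_eqI) (auto simp: mat_def)

lemma adj_sum: "adj (sum f S) = (\<Sum>x\<in>S. adj (f x))"
  by (induction S rule: infinite_finite_induct) (auto simp: adj_add)

lemma cscale_cscale [simp]: "cscale c (cscale d A) = cscale (c * d) A"
  and cscale_one [simp]: "cscale 1 A = A"
  and cscale_zero_left [simp]: "cscale 0 A = 0"
  and cscale_zero_right [simp]: "cscale c 0 = (0::'n::finite cmat)"
  and cscale_add_right: "cscale c (A + B) = cscale c A + cscale c B"
  and cscale_diff_right: "cscale c (A - B) = cscale c A - cscale c B"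
  and cscale_add_left: "cscale (c + d) A = cscale c A + cscale d A"
  and cscale_diff_left: "cscale (c - d) A = cscale c A - cscale d A"
  and cscale_minus_left: "cscale (-c) A = - cscale c A"
  and cscale_of_real: "cscale (of_real r) A = r *\<^sub>R A"
  and cscale_mult_left [simp]: "cscale c A ** B = cscale c (A ** B)"
  and cscale_mult_right [simp]: "A ** cscale c B = cscale c (A ** B)"
  for A B :: "'n::finite cmat"
  by (auto intro!: cmat_eqI simp: matmul_nth sum_distrib_left scaleR_conv_of_real[where 'a=complex] algebra_simps)

lemma matmul_zero [simp]: "A ** 0 = 0" "0 ** A = 0"
  and matmul_add_left: "(A + B) ** C = A ** C + B ** C"
  and matmul_diff_left: "(A - B) ** C = A ** C - B ** C"
  and matmul_diff_right: "C ** (A - B) = C ** A - C ** B"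
  and matmul_scaleR: "(r *\<^sub>R A) ** B = r *\<^sub>R (A ** B)" "A ** (r *\<^sub>R B) = r *\<^sub>R (A ** B)"
  for A B C :: "'n::finite cmat"
  by (auto intro!: cmat_eqI simp: matmul_nth sum.distrib sum_subtractf algebra_simps scaleR_sum_right)

lemma matmul_sum_left: "sum f S ** B = (\<Sum>x\<in>S. f x ** B)" for f :: "'a \<Rightarrow> 'n::finite cmat" and B :: "'n cmat"
  by (induction S rule: infinite_finite_induct) (auto simp: matmul_add_left)

lemma matmul_sum_right: "B ** sum f S = (\<Sum>x\<in>S. B ** f x)" for f :: "'a \<Rightarrow> 'n::finite cmat" and B :: "'n cmat"
  by (induction S rule: infinite_finite_induct) (auto simp: matrix_add_ldistrib)

lemma cscale_sum_right: "cscale c (sum f S) = (\<Sum>x\<in>S. cscale c (f x))"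
  by (induction S rule: infinite_finite_induct) (auto simp: cscale_add_right)

lemma diag_mat_nth: "diag_mat d $ i $ j = (if i = j then d i else 0)"
  by (simp add: diag_mat_def)

lemma matmul_diag_nth: "(A ** diag_mat d) $ i $ j = A $ i $ j * d j"
  by (simp add: matmul_nth diag_mat_nth if_distrib sum.delta cong: if_cong)

lemma diag_matmul_nth: "(diag_mat d ** A) $ i $ j = d i * A $ i $ j"
proof -
  have "(diag_mat d ** A) $ i $ j = (\<Sum>k\<in>UNIV. if i = k then d i * A $ k $ j else 0)"
    unfolding matmul_nth diag_mat_nth by (rule sum.cong) auto
  then show ?thesis by simp
qed

section \<open>The spectral theorem\<close>

text \<open>The type-class inner product on \<open>complex^'n\<close> is real-valued: it is the real
  part of this form. The real one serves compactness and dimension counting, the complex one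
  orthogonality.\<close>

definition cdot :: "complex^'n::finite \<Rightarrow> complex^'n \<Rightarrow> complex" where
  "cdot v w = (\<Sum>i\<in>UNIV. cnj (v $ i) * w $ i)"

lemma cdot_add_right: "cdot v (w + x) = cdot v w + cdot v x"
  and cdot_smult_right: "cdot v (c *s w) = c * cdot v w"
  and cdot_scaleR_right: "cdot v (r *\<^sub>R w) = r *\<^sub>R cdot v w"
  and cdot_zero_right [simp]: "cdot v 0 = 0"
  and cdot_commute: "cdot w v = cnj (cdot v w)"
  and inner_eq_Re_cdot: "v \<bullet> w = Re (cdot v w)"
  by (auto simp: cdot_def sum.distrib sum_subtractf sum_distrib_left scaleR_sum_right inner_vec_def
      inner_complex_def algebra_simps)

lemma cdot_adj: "cdot v (A *v w) = cdot (adj A *v v) w"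
proof -
  have "cdot v (A *v w) = (\<Sum>i\<in>UNIV. \<Sum>j\<in>UNIV. cnj (v $ i) * (A $ i $ j * w $ j))"
    by (simp add: cdot_def matrix_vector_mult_def sum_distrib_left)
  also have "\<dots> = (\<Sum>j\<in>UNIV. \<Sum>i\<in>UNIV. cnj (v $ i) * (A $ i $ j * w $ j))"
    by (rule sum.swap)
  also have "\<dots> = cdot (adj A *v v) w"
    by (simp add: cdot_def matrix_vector_mult_def sum_distrib_right sum_distrib_left mult_ac)
  finally show ?thesis .
qed

lemma cdot_self: "cdot v v = of_real ((norm v)\<^sup>2)"
proof (rule complex_eqI)
  show "Re (cdot v v) = Re (complex_of_real ((norm v)\<^sup>2))"
    using inner_eq_Re_cdot[of v v] by (simp add: power2_norm_eq_inner)
  show "Im (cdot v v) = Im (complex_of_real ((norm v)\<^sup>2))"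
    by (simp add: cdot_def mult.commute)
qed

lemma matvec_scaleR: "A *v (r *\<^sub>R v) = r *\<^sub>R (A *v (v::complex^'n::finite))"
  by (simp add: vec_eq_iff matrix_vector_mult_def scaleR_sum_right)

text \<open>Rayleigh quotient argument: \<open>v \<bullet> (A *v v)\<close> attains its maximum on
  the compact unit sphere of \<open>V\<close>, and a maximizer is an eigenvector. Only the real
  structure of \<open>V\<close> enters.\<close>

lemma hermitian_invariant_eigenvector:
  fixes A :: "'n::finite cmat"
  assumes A: "hermitian A" and V: "subspace V" and inv: "\<And>v. v \<in> V \<Longrightarrow> A *v v \<in> V" and "V \<noteq> {0}"
  obtains v l where "v \<in> V" "norm v = 1" "A *v v = (l::real) *\<^sub>R v"
proof -
  have sym: "v \<bullet> (A *v w) = w \<bullet> (A *v v)" for v w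
    using A by (metis hermitian_def cdot_adj cdot_commute inner_eq_Re_cdot inner_commute)
  obtain u where u: "u \<in> V" "u \<noteq> 0" using V \<open>V \<noteq> {0}\<close> subspace_0 by blast
  let ?S = "V \<inter> sphere 0 1"
  have "(1 / norm u) *\<^sub>R u \<in> ?S" using u V by (auto intro: subspace_scale)
  moreover have "compact ?S"
    by (metis closed_Int_compact closed_subspace V compact_sphere)
  moreover have "continuous_on ?S (\<lambda>v. v \<bullet> (A *v v))"
    by (intro continuous_intros linear_continuous_on) auto
  ultimately obtain v where v: "v \<in> ?S" and max: "\<And>w. w \<in> ?S \<Longrightarrow> w \<bullet> (A *v w) \<le> v \<bullet> (A *v v)"
    using continuous_attains_sup[of ?S "\<lambda>v. v \<bullet> (A *v v)"] by blast
  define l where "l = v \<bullet> (A *v v)"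
  have vv: "v \<bullet> v = 1" and nv: "norm v = 1" using v by (auto simp: dot_square_norm)
  have maxV: "w \<bullet> (A *v w) \<le> l * (w \<bullet> w)" if "w \<in> V" for w
  proof (cases "w = 0")
    case False
    define w' where "w' = (1 / norm w) *\<^sub>R w"
    have "w' \<in> ?S" using that False V by (auto simp: w'_def intro: subspace_scale)
    from max[OF this] have "w' \<bullet> (A *v w') \<le> l" by (simp add: l_def)
    then show ?thesis
      using False by (simp add: w'_def matvec_scaleR divide_simps dot_square_norm
          power2_eq_square mult.assoc)
  qed auto
  \<comment> \<open>The residual of the eigenvalue equation at the maximizer. Moving from
    \<open>v\<close> in the direction \<open>w\<close> must not increase the quotient, which forces
    \<open>w = 0\<close>.\<close>
  define w where "w = A *v v - l *\<^sub>R v"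
  have wV: "w \<in> V" using v V inv by (auto simp: w_def intro!: subspace_diff subspace_scale)
  have wv: "w \<bullet> v = 0" by (simp add: w_def inner_diff vv l_def inner_commute)
  have wAv: "w \<bullet> (A *v v) = w \<bullet> w"
    using wv by (simp add: w_def inner_diff inner_commute algebra_simps)
  define K where "K = l * (w \<bullet> w) - w \<bullet> (A *v w)"
  have "2 * e * (w \<bullet> w) \<le> e\<^sup>2 * K" for e :: real
  proof -
    have "v + e *\<^sub>R w \<in> V" using v V wV by (auto intro!: subspace_add subspace_scale)
    from maxV[OF this] have
      "l + 2 * e * (w \<bullet> w) + e\<^sup>2 * (w \<bullet> (A *v w)) \<le> l * (1 + e\<^sup>2 * (w \<bullet> w))"
      using wv vv sym[of v w] wAv
      by (simp add: inner_add_left inner_add_right matvec_scaleR matrix_vector_right_distrib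
          inner_commute[of v w] power2_eq_square l_def[symmetric] algebra_simps)
    then show ?thesis by (simp add: K_def algebra_simps)
  qed
  note key = this
  have "w \<bullet> w = 0"
  proof (rule ccontr)
    assume "w \<bullet> w \<noteq> 0"
    then have pos: "w \<bullet> w > 0" by simp
    \<comment> \<open>This step is so small that \<open>e * K\<close> is at most
      \<open>w \<bullet> w\<close>, while \<open>key\<close> demands at least twice that.\<close>
    define e where "e = (w \<bullet> w) / (\<bar>K\<bar> + 1)"
    have e: "e > 0" using pos by (simp add: e_def)
    have "2 * (w \<bullet> w) \<le> e * K" using key[of e] e by (simp add: power2_eq_square)
    also have "\<dots> \<le> e * (\<bar>K\<bar> + 1)" using e by (intro mult_left_mono) auto
    also have "\<dots> = w \<bullet> w" by (simp add: e_def)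
    finally show False using pos by simp
  qed
  then have "A *v v = l *\<^sub>R v" by (simp add: w_def)
  then show ?thesis using v nv that by blast
qed

definition orthonormal_eigvecs :: "'n::finite cmat \<Rightarrow> (complex^'n) set \<Rightarrow> bool" where
  "orthonormal_eigvecs A B \<longleftrightarrow> (\<forall>v\<in>B. norm v = 1 \<and> (\<exists>l::real. A *v v = l *\<^sub>R v)) \<and>
     (\<forall>v\<in>B. \<forall>w\<in>B. v \<noteq> w \<longrightarrow> cdot v w = 0)"

lemma cdot_ii: "cdot (\<i> *s v) w = - \<i> * cdot v w"
  by (metis cdot_commute cdot_smult_right complex_cnj_mult complex_cnj_i complex_cnj_cnj)

text \<open>Linear algebra is available over the reals, where \<open>complex^'n\<close> has
  dimension \<open>2 * CARD('n)\<close>. Adjoining the multiples by \<open>\<i>\<close> turns a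
  complex orthonormal family into a real orthogonal one of twice the size.\<close>

lemma orthonormal_eigvecs_realify:
  fixes A :: "'n::finite cmat"
  assumes B: "orthonormal_eigvecs A B"
  defines "C \<equiv> B \<union> (\<lambda>v. \<i> *s v) ` B"
  shows "independent C" "finite B" "card C = 2 * card B"
proof -
  have n: "norm v = 1" if "v \<in> B" for v using B that by (auto simp: orthonormal_eigvecs_def)
  have self: "cdot v v = 1" if "v \<in> B" for v using n[OF that] by (simp add: cdot_self)
  have oth: "cdot v w = 0" if "v \<in> B" "w \<in> B" "v \<noteq> w" for v w
    using B that by (auto simp: orthonormal_eigvecs_def)
  have cases: "cdot v w = 0 \<or> v = w \<and> cdot v w = 1" if "v \<in> B" "w \<in> B" for v w
    using self oth that by blast
  have ort: "x \<bullet> y = 0" if xy: "x \<in> C" "y \<in> C" "x \<noteq> y" for x y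
  proof -
    obtain v where v: "v \<in> B" "x = v \<or> x = \<i> *s v" using xy(1) by (auto simp: C_def)
    obtain w where w: "w \<in> B" "y = w \<or> y = \<i> *s w" using xy(2) by (auto simp: C_def)
    show ?thesis using cases[OF v(1) w(1)] v(2) w(2) xy(3)
      by (auto simp: inner_eq_Re_cdot cdot_ii cdot_smult_right)
  qed
  have disj: "B \<inter> (\<lambda>v. \<i> *s v) ` B = {}"
  proof (rule ccontr)
    assume "B \<inter> (\<lambda>v. \<i> *s v) ` B \<noteq> {}"
    then obtain v where v: "v \<in> B" "\<i> *s v \<in> B" by auto
    have "cdot v (\<i> *s v) = \<i>" using self v by (simp add: cdot_smult_right)
    moreover have "cdot v (\<i> *s v) = 0 \<or> cdot v (\<i> *s v) = 1" using cases v by blast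
    ultimately show False by (auto simp: complex_eq_iff)
  qed
  have inj: "inj_on (\<lambda>v. \<i> *s v) B"
    by (auto simp: inj_on_def vec_eq_iff)
  have z: "0 \<notin> C"
  proof
    assume "0 \<in> C"
    then have "0 \<in> B" by (auto simp: C_def vec_eq_iff)
        (metis vec_eq_iff zero_index)
    then show False using n by force
  qed
  show ind: "independent C"
    by (rule pairwise_orthogonal_independent) (use ort z in \<open>auto simp: pairwise_def orthogonal_def\<close>)
  show fin: "finite B" using independent_imp_finite[OF ind] by (simp add: C_def)
  show "card C = 2 * card B"
    unfolding C_def using card_Un_disjoint[OF fin _ disj] fin card_image[OF inj] by simp
qed

lemma orthonormal_eigvecs_card_le:
  fixes A :: "'n::finite cmat"
  assumes B: "orthonormal_eigvecs A B"
  shows "card B \<le> CARD('n)"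
proof -
  note r = orthonormal_eigvecs_realify[OF B]
  have "card (B \<union> (\<lambda>v. \<i> *s v) ` B) \<le> DIM(complex^'n)"
    by (rule independent_card_le) (rule r)
  then show ?thesis using r by simp
qed

text \<open>A family of maximal cardinality is complete: its complex orthogonal complement is
  \<open>A\<close>-invariant, so a nonzero complement would contribute one more eigenvector.\<close>

lemma orthonormal_eigvecs_exists:
  fixes A :: "'n::finite cmat"
  assumes A: "hermitian A"
  obtains B where "orthonormal_eigvecs A B" "card B = CARD('n)"
proof -
  have "orthonormal_eigvecs A {}" by (simp add: orthonormal_eigvecs_def)
  moreover have "\<forall>B. orthonormal_eigvecs A B \<longrightarrow> card B < Suc CARD('n)"
    using orthonormal_eigvecs_card_le[of A] by (auto simp: less_Suc_eq_le)
  ultimately obtain B where B: "orthonormal_eigvecs A B"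
    and max: "\<And>C. orthonormal_eigvecs A C \<Longrightarrow> card C \<le> card B"
    using ex_has_greatest_nat[of "orthonormal_eigvecs A" "{}" card "Suc CARD('n)"] by (metis less_imp_le_nat)
  note r = orthonormal_eigvecs_realify[OF B]
  define V where "V = {v. \<forall>b\<in>B. cdot b v = 0}"
  have sub: "subspace V"
    by (auto simp: subspace_def V_def cdot_add_right cdot_scaleR_right)
  have inv: "A *v v \<in> V" if "v \<in> V" for v
  proof -
    have "cdot b (A *v v) = 0" if b: "b \<in> B" for b
    proof -
      obtain l :: real where l: "A *v b = l *\<^sub>R b" using B b unfolding orthonormal_eigvecs_def by blast
      have "cdot b (A *v v) = cdot (A *v b) v" using A by (metis hermitian_def cdot_adj)
      also have "\<dots> = cnj (cdot v (l *\<^sub>R b))" unfolding l by (rule cdot_commute)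
      also have "\<dots> = l *\<^sub>R cdot b v"
        using cdot_commute[of v b] by (simp add: cdot_scaleR_right)
      finally show ?thesis using b \<open>v \<in> V\<close> by (simp add: V_def)
    qed
    then show ?thesis by (simp add: V_def)
  qed
  have V0: "V = {0}"
  proof (rule ccontr)
    assume "V \<noteq> {0}"
    then obtain v l where v: "v \<in> V" "norm v = 1" "A *v v = (l::real) *\<^sub>R v"
      using hermitian_invariant_eigenvector[OF A sub inv] by metis
    have o: "cdot b v = 0" "cdot v b = 0" if "b \<in> B" for b
      using v(1) that cdot_commute[of v b] by (auto simp: V_def)
    have "v \<notin> B" using o[of v] v(2) by (auto simp: cdot_self)
    have "orthonormal_eigvecs A (insert v B)"
      using B v o unfolding orthonormal_eigvecs_def by blast
    from max[OF this] show False using \<open>v \<notin> B\<close> r(2) by simp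
  qed
  let ?C = "B \<union> (\<lambda>v. \<i> *s v) ` B"
  have "span ?C = UNIV"
  proof (rule ccontr)
    assume "span ?C \<noteq> UNIV"
    then obtain a where a: "a \<noteq> 0" "\<And>x. x \<in> span ?C \<Longrightarrow> a \<bullet> x = 0"
      using span_not_univ_subset_hyperplane[of ?C] by blast
    have "cdot b a = 0" if "b \<in> B" for b
    proof (rule complex_eqI)
      \<comment> \<open>Real orthogonality to \<open>b\<close> and to \<open>\<i> *s b\<close> kills
        the real and the imaginary part of \<open>cdot b a\<close>.\<close>
      have "a \<bullet> b = 0" "a \<bullet> (\<i> *s b) = 0" using a(2) that by (auto intro: span_base)
      then show "Re (cdot b a) = Re 0" "Im (cdot b a) = Im 0"
        unfolding inner_commute[of a] by (simp_all add: inner_eq_Re_cdot cdot_ii)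
    qed
    then show False using V0 a(1) by (auto simp: V_def)
  qed
  then have "card ?C = DIM(complex^'n)"
    using r(1) by (metis dim_UNIV dim_span_eq_card_independent)
  then show ?thesis using that B r(3) by simp
qed

theorem spectral_theorem:
  fixes A :: "'n::finite cmat"
  assumes "hermitian A"
  obtains U and d :: "'n \<Rightarrow> real"
  where "unitary_mat U" "A = U ** diag_mat (\<lambda>i. complex_of_real (d i)) ** adj U"
proof -
  obtain B where B: "orthonormal_eigvecs A B" "card B = CARD('n)"
    using orthonormal_eigvecs_exists[OF assms] .
  have "finite B" using orthonormal_eigvecs_realify[OF B(1)] by simp
  then obtain b where b: "bij_betw b (UNIV::'n set) B"
    using B(2) finite_same_card_bij[of "UNIV::'n set" B] by auto
  have bB: "b i \<in> B" for i using b by (auto simp: bij_betw_def)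
  have "\<exists>l::real. A *v b i = l *\<^sub>R b i" for i using B(1) bB[of i] unfolding orthonormal_eigvecs_def by blast
  then obtain d :: "'n \<Rightarrow> real" where d: "\<And>i. A *v b i = d i *\<^sub>R b i" by metis
  define U :: "'n cmat" where "U = (\<chi> i j. b j $ i)"
  have "cdot (b i) (b j) = (if i = j then 1 else 0)" for i j
  proof (cases "i = j")
    case True
    then show ?thesis using B(1) bB[of j] by (auto simp: orthonormal_eigvecs_def cdot_self)
  next
    case False
    then have "b i \<noteq> b j" using b by (auto simp: bij_betw_def inj_on_def)
    then show ?thesis using B(1) bB[of i] bB[of j] False by (auto simp: orthonormal_eigvecs_def)
  qed
  then have UU: "adj U ** U = mat 1"
    by (intro cmat_eqI) (simp add: matmul_nth U_def cdot_def mat_def)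
  then have UU': "U ** adj U = mat 1" using matrix_left_right_inverse by blast
  have "A ** U = U ** diag_mat (\<lambda>i. complex_of_real (d i))"
  proof (rule cmat_eqI)
    fix i j
    have "(A ** U) $ i $ j = (A *v b j) $ i"
      by (simp add: matmul_nth U_def matrix_vector_mult_def)
    then show "(A ** U) $ i $ j = (U ** diag_mat (\<lambda>i. complex_of_real (d i))) $ i $ j"
      by (simp add: d matmul_diag_nth U_def scaleR_conv_of_real[where 'a=complex] mult.commute)
  qed
  then have "U ** diag_mat (\<lambda>i. complex_of_real (d i)) ** adj U = A ** (U ** adj U)"
    by (simp add: matrix_mul_assoc)
  then have "A = U ** diag_mat (\<lambda>i. complex_of_real (d i)) ** adj U" by (simp add: UU')
  then show ?thesis using that UU UU' by (auto simp: unitary_mat_def)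
qed

section \<open>Functional calculus\<close>

lemma diag_mat_mult: "diag_mat c ** diag_mat d = diag_mat (\<lambda>i. c i * d i)"
  and diag_mat_add: "diag_mat c + diag_mat d = diag_mat (\<lambda>i. c i + d i)"
  and adj_diag_mat: "adj (diag_mat d) = diag_mat (\<lambda>i. cnj (d i))"
  and cscale_diag_mat: "cscale z (diag_mat d) = diag_mat (\<lambda>i. z * d i)"
  and diag_mat_one: "diag_mat (\<lambda>i. 1) = mat 1"
  by (auto intro!: cmat_eqI simp: matmul_diag_nth diag_mat_nth mat_def)

lemma unitary_mat_cancel:
  assumes "unitary_mat U"
  shows "adj U ** U = mat 1" "U ** adj U = mat 1" "X ** adj U ** U = X" "X ** U ** adj U = X"
  using assms by (simp_all add: unitary_mat_def flip: matrix_mul_assoc)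

lemma unitary_conj_mult:
  "unitary_mat U \<Longrightarrow> (U ** X ** adj U) ** (U ** Y ** adj U) = U ** (X ** Y) ** adj U"
  by (simp add: matrix_mul_assoc unitary_mat_cancel)

lemma unitary_conj_eq_iff:
  assumes "unitary_mat U"
  shows "U ** X ** adj U = U ** Y ** adj U \<longleftrightarrow> X = Y"
proof -
  have "adj U ** (U ** Z ** adj U) ** U = Z" for Z
    using assms by (simp add: matrix_mul_assoc unitary_mat_cancel)
  then show ?thesis by metis
qed

text \<open>The matrix change of basis \<^term>\<open>K = adj V ** U\<close> satisfies \<open>K i j * d j = e i * K i j\<close>, so it
  also intertwines the diagonal matrices of \<open>f d\<close> and \<open>f e\<close>.\<close>

lemma unitary_diag_fun_unique:
  assumes U: "unitary_mat U" and V: "unitary_mat V"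
    and eq: "U ** diag_mat (\<lambda>i. complex_of_real (d i)) ** adj U =
      V ** diag_mat (\<lambda>i. complex_of_real (e i)) ** adj V"
  shows "U ** diag_mat (\<lambda>i. f (d i)) ** adj U = V ** diag_mat (\<lambda>i. f (e i)) ** adj V"
proof -
  define K where "K = adj V ** U"
  note UV = unitary_mat_cancel[OF U] unitary_mat_cancel[OF V]
  have "adj V ** (U ** diag_mat (\<lambda>i. complex_of_real (d i)) ** adj U) ** U =
      adj V ** (V ** diag_mat (\<lambda>i. complex_of_real (e i)) ** adj V) ** U"
    by (simp add: eq)
  then have "K ** diag_mat (\<lambda>i. complex_of_real (d i)) = diag_mat (\<lambda>i. complex_of_real (e i)) ** K"
    by (simp add: K_def matrix_mul_assoc UV)
  then have "K $ i $ j * complex_of_real (d j) = complex_of_real (e i) * K $ i $ j" for i j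
    by (metis matmul_diag_nth diag_matmul_nth)
  then have "K $ i $ j = 0 \<or> d j = e i" for i j
    by (metis mult.commute mult_cancel_left of_real_eq_iff)
  then have "K $ i $ j * f (d j) = f (e i) * K $ i $ j" for i j
    by (metis mult.commute mult_zero_left)
  then have "K ** diag_mat (\<lambda>i. f (d i)) = diag_mat (\<lambda>i. f (e i)) ** K"
    by (intro cmat_eqI) (simp add: matmul_diag_nth diag_matmul_nth)
  then have "V ** (K ** diag_mat (\<lambda>i. f (d i))) ** adj U = V ** (diag_mat (\<lambda>i. f (e i)) ** K) ** adj U"
    by simp
  then show ?thesis
    by (simp add: K_def matrix_mul_assoc UV)
qed

text \<open>Discharges the \<open>SOME\<close> in \<open>matfun\<close>: since all diagonalizations
  give the same value, any one of them may be used to compute it.\<close>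

lemma matfun_unitary_conj:
  assumes "unitary_mat U" and "A = U ** diag_mat (\<lambda>i. complex_of_real (d i)) ** adj U"
  shows "matfun f A = U ** diag_mat (\<lambda>i. f (d i)) ** adj U"
  unfolding matfun_def
  by (rule some_equality) (use assms unitary_diag_fun_unique in blast)+

definition eigproj :: "'n::finite cmat \<Rightarrow> real \<Rightarrow> 'n cmat" where
  "eigproj A l = matfun (\<lambda>x. if x = l then 1 else 0) A"

definition spec :: "'n::finite cmat \<Rightarrow> real set" where
  "spec A = {l. eigproj A l \<noteq> 0}"

lemma spec_unitary_conj:
  assumes "unitary_mat U" and "A = U ** diag_mat (\<lambda>i. complex_of_real (d i)) ** adj U"
  shows "spec A = range d"
proof -
  have "eigproj A l = 0 \<longleftrightarrow> l \<notin> range d" for l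
  proof -
    have "eigproj A l = 0 \<longleftrightarrow>
        U ** diag_mat (\<lambda>i. if d i = l then 1 else 0) ** adj U = U ** 0 ** adj U"
      unfolding eigproj_def matfun_unitary_conj[OF assms] by simp
    also have "\<dots> \<longleftrightarrow> (\<forall>i. d i \<noteq> l)"
      unfolding unitary_conj_eq_iff[OF assms(1)] by (auto simp: vec_eq_iff diag_mat_nth)
    finally show ?thesis by auto
  qed
  then show ?thesis by (auto simp: spec_def)
qed

context
  fixes A :: "'n::finite cmat"
  assumes A: "hermitian A"
begin

lemma finite_spec: "finite (spec A)"
  using spectral_theorem[OF A] by (metis spec_unitary_conj finite_imageI finite)

lemma matfun_cong:
  assumes "\<And>l. l \<in> spec A \<Longrightarrow> f l = g l"
  shows "matfun f A = matfun g A"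
proof -
  obtain U and d :: "'n \<Rightarrow> real" where U: "unitary_mat U"
    "A = U ** diag_mat (\<lambda>i. complex_of_real (d i)) ** adj U" using spectral_theorem[OF A] .
  have "f (d i) = g (d i)" for i using assms spec_unitary_conj[OF U] by auto
  then show ?thesis unfolding matfun_unitary_conj[OF U] by simp
qed

lemma matfun_mult: "matfun f A ** matfun g A = matfun (\<lambda>x. f x * g x) A"
  and matfun_add: "matfun f A + matfun g A = matfun (\<lambda>x. f x + g x) A"
  and adj_matfun: "adj (matfun f A) = matfun (\<lambda>x. cnj (f x)) A"
  and cscale_matfun: "cscale z (matfun f A) = matfun (\<lambda>x. z * f x) A"
  and matfun_const: "matfun (\<lambda>x. z) A = cscale z (mat 1)"
  and matfun_id: "matfun complex_of_real A = A"
proof -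
  obtain U and d :: "'n \<Rightarrow> real" where U: "unitary_mat U"
    "A = U ** diag_mat (\<lambda>i. complex_of_real (d i)) ** adj U" using spectral_theorem[OF A] .
  note m = matfun_unitary_conj[OF U]
  show "matfun f A ** matfun g A = matfun (\<lambda>x. f x * g x) A"
    unfolding m unitary_conj_mult[OF U(1)] diag_mat_mult ..
  show "matfun f A + matfun g A = matfun (\<lambda>x. f x + g x) A"
    unfolding m diag_mat_add[symmetric] by (simp add: matmul_add_left matrix_add_ldistrib)
  show "adj (matfun f A) = matfun (\<lambda>x. cnj (f x)) A"
    unfolding m by (simp add: adj_mult adj_diag_mat matrix_mul_assoc)
  show "cscale z (matfun f A) = matfun (\<lambda>x. z * f x) A"
    unfolding m cscale_diag_mat[symmetric] by simp
  have "diag_mat (\<lambda>i. z) = cscale z (mat 1 :: 'n cmat)"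
    unfolding diag_mat_one[symmetric] cscale_diag_mat by simp
  then show "matfun (\<lambda>x. z) A = cscale z (mat 1)"
    unfolding m using U(1) by (simp add: unitary_mat_def)
  show "matfun complex_of_real A = A"
    unfolding m U(2)[symmetric] ..
qed

lemma matfun_zero: "matfun (\<lambda>x. 0) A = 0"
  by (simp add: matfun_const)

lemma matfun_sum: "finite S \<Longrightarrow> (\<Sum>k\<in>S. matfun (f k) A) = matfun (\<lambda>x. \<Sum>k\<in>S. f k x) A"
  by (induction S rule: finite_induct) (auto simp: matfun_zero matfun_add)

text \<open>Functions enter only through finitely many scalar coefficients in front of fixed
  projections; membership, continuity and integration arguments all rest on this form.\<close>

lemma matfun_expand: "matfun f A = (\<Sum>l\<in>spec A. cscale (f l) (eigproj A l))"
proof -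
  have "(\<Sum>l\<in>spec A. cscale (f l) (eigproj A l)) =
      matfun (\<lambda>x. \<Sum>l\<in>spec A. f l * (if x = l then 1 else 0)) A"
    by (simp add: eigproj_def cscale_matfun matfun_sum finite_spec)
  also have "\<dots> = matfun f A"
    by (rule matfun_cong) (simp add: finite_spec if_distrib cong: if_cong)
  finally show ?thesis ..
qed

lemma eigproj_mult: "eigproj A l ** eigproj A m = (if l = m then eigproj A l else 0)"
proof -
  have "eigproj A l ** eigproj A m = matfun (\<lambda>x. if x = l \<and> l = m then 1 else 0) A"
    unfolding eigproj_def matfun_mult by (rule matfun_cong) auto
  then show ?thesis by (auto simp: eigproj_def matfun_zero)
qed

lemma adj_eigproj: "adj (eigproj A l) = eigproj A l"
  unfolding eigproj_def adj_matfun by (rule matfun_cong) auto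

lemma matfun_eigproj: "matfun f A ** eigproj A l = cscale (f l) (eigproj A l)"
  and eigproj_matfun: "eigproj A l ** matfun f A = cscale (f l) (eigproj A l)"
  unfolding eigproj_def matfun_mult cscale_matfun by (rule matfun_cong; simp)+

lemma mult_eigproj: "A ** eigproj A l = cscale (of_real l) (eigproj A l)"
  and eigproj_mult_self: "eigproj A l ** A = cscale (of_real l) (eigproj A l)"
  using matfun_eigproj[of complex_of_real l] eigproj_matfun[of l complex_of_real]
  by (simp_all add: matfun_id)

lemma sum_eigproj: "(\<Sum>l\<in>spec A. eigproj A l) = mat 1"
  using matfun_expand[of "\<lambda>x. 1"] by (simp add: matfun_const)

text \<open>On a finite spectrum every function is a polynomial. The Lagrange interpolation
  polynomial of a spectral point places its projection in \<open>M\<close>, and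
  \<open>matfun_expand\<close> does the rest.\<close>

lemma matfun_in_star_subalg:
  assumes M: "star_subalg M" and "A \<in> M"
  shows "matfun f A \<in> M"
proof -
  have M1: "mat 1 \<in> M" and Madd: "\<And>x y. x \<in> M \<Longrightarrow> y \<in> M \<Longrightarrow> x + y \<in> M"
    and Mmult: "\<And>x y. x \<in> M \<Longrightarrow> y \<in> M \<Longrightarrow> x ** y \<in> M" and Msc: "\<And>c x. x \<in> M \<Longrightarrow> cscale c x \<in> M"
    using M by (auto simp: star_subalg_def)
  have lin: "matfun (\<lambda>x. a * of_real x + b) A \<in> M" for a b
    using Madd[OF Msc[OF \<open>A \<in> M\<close>, of a] Msc[OF M1, of b]]
    by (simp add: cscale_matfun[of a complex_of_real, unfolded matfun_id] matfun_add flip: matfun_const)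
  have ind: "matfun (\<lambda>x. \<Prod>m\<in>S. of_real (x - m) / of_real (l - m)) A \<in> M" if "finite S" for S l
    using that
  proof (induction S rule: finite_induct)
    case empty
    show ?case using M1 by (simp add: matfun_const)
  next
    case (insert m S)
    have "matfun (\<lambda>x. (1 / of_real (l - m)) * of_real x + (- of_real m / of_real (l - m))) A **
      matfun (\<lambda>x. \<Prod>m\<in>S. of_real (x - m) / of_real (l - m)) A \<in> M"
      by (intro Mmult insert.IH lin)
    then show ?case using insert.hyps
      by (simp add: matfun_mult diff_divide_distrib)
  qed
  have proj: "eigproj A l \<in> M" if "l \<in> spec A" for l
  proof -
    let ?S = "spec A - {l}"
    have "eigproj A l = matfun (\<lambda>x. \<Prod>m\<in>?S. of_real (x - m) / of_real (l - m)) A"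
      unfolding eigproj_def
    proof (rule matfun_cong)
      fix x assume x: "x \<in> spec A"
      show "(if x = l then 1 else 0) = (\<Prod>m\<in>?S. complex_of_real (x - m) / of_real (l - m))"
      proof (cases "x = l")
        case True
        have "(\<Prod>m\<in>?S. complex_of_real (l - m) / of_real (l - m)) = (\<Prod>m\<in>?S. 1)"
          by (rule prod.cong) auto
        then show ?thesis using True by simp
      next
        case False
        have "\<exists>m\<in>?S. complex_of_real (x - m) / of_real (l - m) = 0"
          using x False by (intro bexI[of _ x]) auto
        then have "(\<Prod>m\<in>?S. complex_of_real (x - m) / of_real (l - m)) = 0"
          by (intro prod_zero) (auto simp: finite_spec)
        then show ?thesis using False by simp
      qed
    qed
    then show ?thesis using ind[of ?S l] finite_spec by auto
  qed
  have M0: "0 \<in> M" using Msc[OF M1, of 0] by simp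
  have "finite S \<Longrightarrow> S \<subseteq> spec A \<Longrightarrow> (\<Sum>l\<in>S. cscale (f l) (eigproj A l)) \<in> M" for S
    by (induction S rule: finite_induct) (auto intro!: M0 Madd Msc proj)
  then show ?thesis unfolding matfun_expand using finite_spec by blast
qed

lemma eigproj_in_star_subalg: "star_subalg M \<Longrightarrow> A \<in> M \<Longrightarrow> eigproj A l \<in> M"
  unfolding eigproj_def by (rule matfun_in_star_subalg)

end

lemma matfun_hermitian_comp:
  assumes A: "hermitian A"
  shows "matfun f (matfun (\<lambda>x. complex_of_real (g x)) A) = matfun (\<lambda>x. f (g x)) A"
proof -
  obtain U and d :: "'a \<Rightarrow> real" where U: "unitary_mat U"
    "A = U ** diag_mat (\<lambda>i. complex_of_real (d i)) ** adj U" using spectral_theorem[OF A] .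
  show ?thesis
    unfolding matfun_unitary_conj[OF U]
    by (rule matfun_unitary_conj[OF U(1)]) simp
qed

lemma mabs_hermitian:
  assumes "hermitian A"
  shows "mabs A = matfun (\<lambda>x. complex_of_real \<bar>x\<bar>) A"
proof -
  have "adj A ** A = matfun (\<lambda>x. complex_of_real (x\<^sup>2)) A"
    using assms matfun_mult[OF assms, of complex_of_real complex_of_real]
    by (simp add: hermitian_def matfun_id power2_eq_square)
  then show ?thesis
    by (simp add: mabs_def matfun_hermitian_comp[OF assms] del: of_real_power)
qed

section \<open>Positive definite matrices and their complex powers\<close>

lemma psd_adj_mult: "psd (adj a ** a)"
proof -
  have "(\<Sum>i\<in>UNIV. cnj (v $ i) * ((adj a ** a) *v v) $ i) = cdot (a *v v) (a *v v)" for v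
    using cdot_adj[of v "adj a" "a *v v"]
    by (simp add: cdot_def[symmetric] matrix_vector_mul_assoc)
  then show ?thesis
    by (simp add: psd_def hermitian_def adj_mult cdot_self)
qed

text \<open>Stated on the spectrum, so that scalar identities for \<open>ln\<close> and
  \<open>powr\<close> valid on positive reals lift to matrices through
  \<open>matfun_cong\<close>.\<close>

definition posdef :: "'n::finite cmat \<Rightarrow> bool" where
  "posdef A \<longleftrightarrow> hermitian A \<and> (\<forall>l\<in>spec A. 0 < l)"

lemma posdef_hermitian: "posdef A \<Longrightarrow> hermitian A"
  by (simp add: posdef_def)

text \<open>A nonzero vector in the range of \<open>eigproj A l\<close> is an eigenvector for
  \<open>l\<close>: positivity of the form gives \<open>0 \<le> l\<close>, invertibility excludes
  0.\<close>

lemma psd_invertible_imp_posdef: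
  assumes "psd A" "invertible A"
  shows "posdef A"
proof -
  have A: "hermitian A" using assms by (simp add: psd_def)
  have "0 < l" if l: "l \<in> spec A" for l
  proof -
    have "eigproj A l \<noteq> 0" using l by (simp add: spec_def)
    then obtain v where v: "eigproj A l *v v \<noteq> 0"
      by (metis matrix_eq matrix_vector_mult_0)
    define w where "w = eigproj A l *v v"
    have Aw: "A *v w = complex_of_real l *s w"
      unfolding w_def matrix_vector_mul_assoc mult_eigproj[OF A]
      by (simp add: vec_eq_iff matrix_vector_mult_def sum_distrib_left mult.assoc)
    have "0 \<le> Re (cdot w (A *v w))"
      using assms(1) by (simp add: psd_def cdot_def)
    then have "0 \<le> l * (norm w)\<^sup>2"
      by (simp add: Aw cdot_smult_right cdot_self)
    moreover have w0: "w \<noteq> 0" using v by (simp add: w_def)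
    ultimately have "0 \<le> l" by (simp add: zero_le_mult_iff)
    moreover have "l \<noteq> 0"
    proof
      assume "l = 0"
      then have "A *v w = 0" using Aw by simp
      obtain B where "B ** A = mat 1" using assms(2) by (auto simp: invertible_def)
      then have "w = B *v (A *v w)" by (simp add: matrix_vector_mul_assoc)
      then show False using w0 \<open>A *v w = 0\<close> by simp
    qed
    ultimately show ?thesis by simp
  qed
  then show ?thesis using A by (simp add: posdef_def)
qed

lemma matfun_cong_posdef:
  "posdef A \<Longrightarrow> (\<And>l. 0 < l \<Longrightarrow> f l = g l) \<Longrightarrow> matfun f A = matfun g A"
  by (rule matfun_cong) (auto simp: posdef_def)

lemma mpow_add:
  assumes "posdef A"
  shows "mpow A z ** mpow A w = mpow A (z + w)"
  unfolding mpow_def matfun_mult[OF posdef_hermitian[OF assms]]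
  by (rule matfun_cong_posdef[OF assms]) (simp add: powr_add)

lemma mpow_0: "posdef A \<Longrightarrow> mpow A 0 = mat 1"
  using matfun_cong_posdef[of A "\<lambda>s. complex_of_real s powr 0" "\<lambda>s. 1"]
  by (simp add: mpow_def matfun_const posdef_hermitian)

lemma mpow_1: "posdef A \<Longrightarrow> mpow A 1 = A"
  using matfun_cong_posdef[of A "\<lambda>s. complex_of_real s powr 1" complex_of_real]
  by (simp add: mpow_def matfun_id posdef_hermitian)

lemma adj_mpow:
  assumes "posdef A"
  shows "adj (mpow A z) = mpow A (cnj z)"
  unfolding mpow_def adj_matfun[OF posdef_hermitian[OF assms]]
  by (rule matfun_cong_posdef[OF assms]) (simp add: cnj_powr)

lemma mpow_in_star_subalg: "star_subalg M \<Longrightarrow> A \<in> M \<Longrightarrow> posdef A \<Longrightarrow> mpow A z \<in> M"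
  unfolding mpow_def by (intro matfun_in_star_subalg posdef_hermitian)

lemma matrix_inv_posdef:
  assumes "posdef A"
  shows "matrix_inv A = mpow A (-1)"
proof -
  have 1: "A ** mpow A (-1) = mat 1" "mpow A (-1) ** A = mat 1"
    using mpow_add[OF assms, of 1 "-1"] mpow_add[OF assms, of "-1" 1] assms
    by (simp_all add: mpow_1 mpow_0)
  show ?thesis
    unfolding matrix_inv_def
  proof (rule some_equality)
    fix B assume "A ** B = mat 1 \<and> B ** A = mat 1"
    then have "mpow A (-1) ** (A ** B) = mpow A (-1)" by simp
    then show "B = mpow A (-1)" by (simp add: matrix_mul_assoc 1)
  qed (use 1 in simp)
qed

section \<open>Traces and conditional expectations\<close>

lemma adj_mult_eq_0_imp:
  assumes "adj a ** a = 0" shows "a = 0"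
proof -
  have "(\<Sum>i\<in>UNIV. (cmod (a $ i $ j))\<^sup>2) = 0" for j
  proof -
    have "complex_of_real (\<Sum>i\<in>UNIV. (cmod (a $ i $ j))\<^sup>2) = (adj a ** a) $ j $ j"
      by (simp add: matmul_nth mult.commute complex_norm_square del: of_real_power)
    then show ?thesis unfolding assms by (simp only: zero_index of_real_eq_0_iff)
  qed
  then have "\<forall>i j. a $ i $ j = 0" by (simp add: sum_nonneg_eq_0_iff)
  then show ?thesis by (simp add: vec_eq_iff)
qed

locale trace_algebra =
  fixes M :: "'n::finite cmat set" and tau :: "'n cmat \<Rightarrow> complex"
  assumes star_subalg: "star_subalg M" and trace: "faithful_trace M tau"
begin

lemma one_in [simp, intro]: "mat 1 \<in> M"
  and add_in [simp, intro]: "x \<in> M \<Longrightarrow> y \<in> M \<Longrightarrow> x + y \<in> M"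
  and mult_in [simp, intro]: "x \<in> M \<Longrightarrow> y \<in> M \<Longrightarrow> x ** y \<in> M"
  and cscale_in [simp, intro]: "x \<in> M \<Longrightarrow> cscale c x \<in> M"
  and adj_in [simp, intro]: "x \<in> M \<Longrightarrow> adj x \<in> M"
  using star_subalg by (auto simp: star_subalg_def)

lemma zero_in [simp, intro]: "0 \<in> M"
  using cscale_in[OF one_in, of 0] by simp

lemma diff_in [simp, intro]: "x \<in> M \<Longrightarrow> y \<in> M \<Longrightarrow> x - y \<in> M"
  using add_in[OF _ cscale_in[of y "-1"], of x] by (simp add: cscale_minus_left)

lemma sum_in [intro]: "(\<And>k. k \<in> S \<Longrightarrow> f k \<in> M) \<Longrightarrow> sum f S \<in> M"
  by (induction S rule: infinite_finite_induct) auto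

lemma mpow_in [simp, intro]: "x \<in> M \<Longrightarrow> posdef x \<Longrightarrow> mpow x z \<in> M"
  by (rule mpow_in_star_subalg[OF star_subalg])

lemma eigproj_in [simp, intro]: "x \<in> M \<Longrightarrow> hermitian x \<Longrightarrow> eigproj x l \<in> M"
  by (rule eigproj_in_star_subalg[OF _ star_subalg])

lemma tau_add: "x \<in> M \<Longrightarrow> y \<in> M \<Longrightarrow> tau (x + y) = tau x + tau y"
  and tau_cscale: "x \<in> M \<Longrightarrow> tau (cscale c x) = c * tau x"
  and tau_commute: "x \<in> M \<Longrightarrow> y \<in> M \<Longrightarrow> tau (x ** y) = tau (y ** x)"
  using trace by (auto simp: faithful_trace_def)

lemma tau_psd: "x \<in> M \<Longrightarrow> psd x \<Longrightarrow> Im (tau x) = 0 \<and> 0 \<le> Re (tau x)"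
  and tau_psd_pos: "x \<in> M \<Longrightarrow> psd x \<Longrightarrow> x \<noteq> 0 \<Longrightarrow> 0 < Re (tau x)"
  using trace by (auto simp: faithful_trace_def)

lemma tau_zero [simp]: "tau 0 = 0"
  using tau_cscale[OF one_in, of 0] by simp

lemma tau_diff: "x \<in> M \<Longrightarrow> y \<in> M \<Longrightarrow> tau (x - y) = tau x - tau y"
  using tau_add[OF _ cscale_in[of y "-1"], of x] tau_cscale[of y "-1"] by (simp add: cscale_minus_left)

lemma tau_sum: "(\<And>k. k \<in> S \<Longrightarrow> f k \<in> M) \<Longrightarrow> tau (sum f S) = (\<Sum>k\<in>S. tau (f k))"
  by (induction S rule: infinite_finite_induct) (auto simp: tau_add sum_in)

lemma tau_cycle: "x \<in> M \<Longrightarrow> y \<in> M \<Longrightarrow> z \<in> M \<Longrightarrow> tau (x ** y ** z) = tau (z ** x ** y)"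
  using tau_commute[of "x ** y" z] by (simp add: matrix_mul_assoc)

lemma tau_adj_mult:
  assumes "a \<in> M"
  shows "Im (tau (adj a ** a)) = 0" "0 \<le> Re (tau (adj a ** a))"
  using tau_psd[OF _ psd_adj_mult, of a] assms by auto

lemma tau_adj_mult_pos:
  assumes "a \<in> M" "a \<noteq> 0"
  shows "0 < Re (tau (adj a ** a))"
  using tau_psd_pos[OF _ psd_adj_mult, of a] assms adj_mult_eq_0_imp by blast

text \<open>Reality of the trace is assumed on positive elements only; the polarization 4 h = (h +
  1)^2 - (h - 1)^2 writes a Hermitian element as a difference of two such squares.\<close>

lemma tau_hermitian:
  assumes "h \<in> M" "hermitian h"
  shows "Im (tau h) = 0"
proof -
  define a b where "a = h + mat 1" and "b = h - mat 1"
  have ab: "a \<in> M" "b \<in> M" and sa: "adj a = a" "adj b = b"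
    using assms by (auto simp: a_def b_def hermitian_def adj_add adj_diff)
  have "cscale 4 h = adj a ** a - adj b ** b"
    unfolding sa unfolding a_def b_def
    by (simp add: matmul_add_left matrix_add_ldistrib matmul_diff_left matmul_diff_right)
      (intro cmat_eqI, simp)
  then have "4 * tau h = tau (adj a ** a) - tau (adj b ** b)"
    using ab assms(1) by (metis tau_cscale tau_diff adj_in mult_in)
  moreover have "Im (tau (adj a ** a)) = 0" "Im (tau (adj b ** b)) = 0"
    using tau_adj_mult ab by auto
  ultimately have "Im (4 * tau h) = 0" by simp
  then show ?thesis by simp
qed

text \<open>The trace is real on the Hermitian elements x + adj x and i (x - adj x); their vanishing
  imaginary parts compare the imaginary and the real parts of the two traces.\<close>

lemma tau_adj:
  assumes "x \<in> M"
  shows "tau (adj x) = cnj (tau x)"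
proof -
  define h k where "h = x + adj x" and "k = cscale \<i> (x - adj x)"
  have hk: "h \<in> M" "k \<in> M" using assms by (auto simp: h_def k_def)
  have "hermitian h"
    by (simp add: hermitian_def h_def adj_add add.commute)
  moreover have "hermitian k"
    unfolding hermitian_def k_def by (rule cmat_eqI) (simp add: algebra_simps)
  ultimately have "Im (tau h) = 0" "Im (tau k) = 0" using tau_hermitian hk by auto
  moreover have "tau h = tau x + tau (adj x)" "tau k = \<i> * (tau x - tau (adj x))"
    using assms by (auto simp: h_def k_def tau_add tau_diff tau_cscale)
  ultimately show ?thesis by (auto simp: complex_eq_iff)
qed

section \<open>Hilbert-Schmidt and GNS norms\<close>

definition hs_norm :: "'n cmat \<Rightarrow> real" where
  "hs_norm a = sqrt (Re (tau (adj a ** a)))"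

lemma hs_norm_ge_0: "a \<in> M \<Longrightarrow> 0 \<le> hs_norm a"
  by (simp add: hs_norm_def tau_adj_mult)

lemma hs_norm_sq:
  assumes "a \<in> M"
  shows "(hs_norm a)\<^sup>2 = Re (tau (adj a ** a))" "of_real ((hs_norm a)\<^sup>2) = tau (adj a ** a)"
  using tau_adj_mult[OF assms] by (auto simp: hs_norm_def complex_eq_iff)

lemma hs_cauchy_schwarz:
  assumes a: "a \<in> M" and b: "b \<in> M"
  shows "cmod (tau (adj a ** b)) \<le> hs_norm a * hs_norm b"
proof (cases "b = 0")
  case True
  then show ?thesis by (simp add: hs_norm_def)
next
  case False
  define nb where "nb = Re (tau (adj b ** b))"
  have nb: "nb > 0" "tau (adj b ** b) = of_real nb"
    using tau_adj_mult_pos[OF b False] tau_adj_mult[OF b] by (auto simp: nb_def complex_eq_iff)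
  define z where "z = tau (adj a ** b)"
  have z': "tau (adj b ** a) = cnj z"
    using tau_adj[of "adj a ** b"] a b by (simp add: z_def adj_mult)
  \<comment> \<open>The coefficient of the orthogonal projection of \<open>a\<close> onto
    \<open>b\<close>; positivity of the squared norm of the remainder \<open>d\<close> is the
    inequality.\<close>
  define c where "c = cnj z / of_real nb"
  define d where "d = a - cscale c b"
  have d: "d \<in> M" using a b by (simp add: d_def)
  have "tau (adj d ** d) = tau (adj a ** a) - c * z - cnj c * cnj z + cnj c * c * of_real nb"
    unfolding d_def adj_diff adj_cscale matmul_diff_left matmul_diff_right
    using a b by (simp add: cscale_diff_right tau_diff tau_cscale nb z_def[symmetric] z')
  also have "\<dots> = tau (adj a ** a) - of_real ((cmod z)\<^sup>2 / nb)"
    unfolding c_def using nb(1) by (simp add: field_simps flip: complex_norm_square)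
  finally have "(cmod z)\<^sup>2 / nb \<le> Re (tau (adj a ** a))"
    using tau_adj_mult(2)[OF d] by simp
  then have "(cmod z)\<^sup>2 \<le> (hs_norm a * hs_norm b)\<^sup>2"
    using nb(1) a b by (simp add: field_simps power_mult_distrib hs_norm_sq nb_def)
  then show ?thesis
    unfolding z_def by (rule power2_le_imp_le) (simp add: hs_norm_ge_0 a b)
qed

lemma hs_norm_diff_le:
  assumes a: "a \<in> M" and b: "b \<in> M"
  shows "hs_norm (a - b) \<le> hs_norm a + hs_norm b"
proof -
  have "tau (adj (a - b) ** (a - b)) =
      tau (adj a ** a) + tau (adj b ** b) - tau (adj a ** b) - cnj (tau (adj a ** b))"
    unfolding adj_diff matmul_diff_left matmul_diff_right
    using a b tau_adj[of "adj a ** b"] by (simp add: tau_diff adj_mult)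
  then have "(hs_norm (a - b))\<^sup>2 = (hs_norm a)\<^sup>2 + (hs_norm b)\<^sup>2 - 2 * Re (tau (adj a ** b))"
    using a b by (simp add: hs_norm_sq)
  also have "- Re (tau (adj a ** b)) \<le> hs_norm a * hs_norm b"
    using hs_cauchy_schwarz[OF a b] abs_Re_le_cmod[of "tau (adj a ** b)"] by linarith
  then have "(hs_norm a)\<^sup>2 + (hs_norm b)\<^sup>2 - 2 * Re (tau (adj a ** b)) \<le> (hs_norm a + hs_norm b)\<^sup>2"
    by (simp add: power2_sum)
  finally show ?thesis
    by (rule power2_le_imp_le) (simp add: hs_norm_ge_0 a b)
qed

text \<open>The norm of the GNS space of \<open>\<rho>\<close>, with square tau(adj a a rho).
  Writing it through the square root of \<open>\<rho>\<close> lets it inherit Cauchy-Schwarz and the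
  triangle inequality from \<open>hs_norm\<close>.\<close>

definition gns_norm :: "'n cmat \<Rightarrow> 'n cmat \<Rightarrow> real" where
  "gns_norm \<rho> a = hs_norm (a ** mpow \<rho> (1/2))"

context
  fixes \<rho> assumes \<rho>: "\<rho> \<in> M" "posdef \<rho>"
begin

lemma gns_form_eq:
  assumes "a \<in> M" "b \<in> M"
  shows "tau (adj a ** b ** \<rho>) = tau (adj (a ** mpow \<rho> (1/2)) ** (b ** mpow \<rho> (1/2)))"
proof -
  let ?r = "mpow \<rho> (1/2)"
  have r: "?r \<in> M" "adj ?r = ?r" "?r ** ?r = \<rho>"
    using \<rho> adj_mpow[OF \<rho>(2), of "1/2"] mpow_add[OF \<rho>(2), of "1/2" "1/2"] by (auto simp: mpow_1)
  have "tau (adj (a ** ?r) ** (b ** ?r)) = tau (?r ** (adj a ** b) ** ?r)"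
    by (simp add: adj_mult r matrix_mul_assoc)
  also have "\<dots> = tau ((adj a ** b) ** ?r ** ?r)"
    using r assms by (intro tau_cycle[symmetric]) auto
  finally show ?thesis by (simp add: r flip: matrix_mul_assoc)
qed

lemma gns_cauchy_schwarz:
  assumes "a \<in> M" "b \<in> M"
  shows "cmod (tau (adj a ** b ** \<rho>)) \<le> gns_norm \<rho> a * gns_norm \<rho> b"
  unfolding gns_form_eq[OF assms] gns_norm_def
  by (rule hs_cauchy_schwarz) (use assms \<rho> in auto)

lemma gns_norm_ge_0: "a \<in> M \<Longrightarrow> 0 \<le> gns_norm \<rho> a"
  using \<rho> by (auto simp: gns_norm_def intro!: hs_norm_ge_0)

lemma gns_norm_sq:
  assumes "a \<in> M"
  shows "(gns_norm \<rho> a)\<^sup>2 = Re (tau (adj a ** a ** \<rho>))"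
    "of_real ((gns_norm \<rho> a)\<^sup>2) = tau (adj a ** a ** \<rho>)"
  unfolding gns_form_eq[OF assms assms] gns_norm_def
  using assms \<rho> by (intro hs_norm_sq mult_in mpow_in; simp)+

lemma gns_norm_diff_le:
  "a \<in> M \<Longrightarrow> b \<in> M \<Longrightarrow> gns_norm \<rho> (a - b) \<le> gns_norm \<rho> a + gns_norm \<rho> b"
  unfolding gns_norm_def matmul_diff_left
  using \<rho> by (auto intro!: hs_norm_diff_le)

end

end

section \<open>The conditional expectation\<close>

locale trace_subalgebra = trace_algebra M tau for M :: "'n::finite cmat set" and tau +
  fixes N :: "'n cmat set" and E :: "'n cmat \<Rightarrow> 'n cmat"
  assumes N_subalg: "star_subalg N" and N_subset: "N \<subseteq> M" and cond_exp: "cond_exp M N tau E"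
begin

lemma faithful_trace_N: "faithful_trace N tau"
  unfolding faithful_trace_def
proof (intro conjI ballI allI)
  fix x y c assume "x \<in> N" "y \<in> N"
  then have xy: "x \<in> M" "y \<in> M" using N_subset by auto
  show "tau (x + y) = tau x + tau y" "tau (cscale c x) = c * tau x" "tau (x ** y) = tau (y ** x)"
    using tau_add[OF xy] tau_cscale[OF xy(1)] tau_commute[OF xy] by auto
  show "psd x \<longrightarrow> Im (tau x) = 0 \<and> 0 \<le> Re (tau x)" "psd x \<and> x \<noteq> 0 \<longrightarrow> 0 < Re (tau x)"
    using tau_psd tau_psd_pos xy by auto
qed

sublocale N: trace_algebra N tau
  by unfold_locales (rule N_subalg faithful_trace_N)+

lemma in_M [simp, intro]: "x \<in> N \<Longrightarrow> x \<in> M"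
  using N_subset by auto

lemma E_in: "y \<in> M \<Longrightarrow> E y \<in> N"
  and tau_E: "x \<in> N \<Longrightarrow> y \<in> M \<Longrightarrow> tau (x ** E y) = tau (x ** y)"
  using cond_exp by (auto simp: cond_exp_def)

lemma tau_E': "x \<in> N \<Longrightarrow> y \<in> M \<Longrightarrow> tau (E y ** x) = tau (y ** x)"
  using tau_E[of x y] tau_commute[of x y] tau_commute[of x "E y"] E_in[of y] by simp

lemma tau_E_one: "y \<in> M \<Longrightarrow> tau (E y) = tau y"
  using tau_E[of "mat 1" y] N.one_in by simp

text \<open>\<open>E\<close> is known only through its trace identity, so equalities in
  \<open>N\<close> are proved by faithfulness: the anti-Hermitian defect is orthogonal to all of
  \<open>N\<close>, hence to itself.\<close>

lemma E_hermitian: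
  assumes "y \<in> M" "hermitian y"
  shows "hermitian (E y)"
proof -
  define h where "h = E y - adj (E y)"
  have h: "h \<in> N" using E_in[OF assms(1)] by (simp add: h_def)
  have "tau (x ** h) = 0" if x: "x \<in> N" for x
  proof -
    have "tau (x ** adj (E y)) = tau (adj (E y ** adj x))" by (simp add: adj_mult)
    also have "\<dots> = cnj (tau (E y ** adj x))"
      using x E_in assms by (intro tau_adj) auto
    also have "\<dots> = cnj (tau (y ** adj x))" using x assms by (simp add: tau_E')
    also have "\<dots> = tau (adj (y ** adj x))" using x assms by (intro tau_adj[symmetric]) auto
    also have "\<dots> = tau (x ** E y)" using x assms by (simp add: adj_mult hermitian_def tau_E)
    finally show ?thesis
      using x E_in[OF assms(1)] by (simp add: h_def matmul_diff_right tau_diff)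
  qed
  from this[of "adj h"] have "tau (adj h ** h) = 0" using h by simp
  then have "h = 0" using tau_adj_mult_pos[of h] h by force
  then show ?thesis by (simp add: h_def hermitian_def)
qed

text \<open>For a spectral projection P of \<open>E y\<close> with eigenvalue l, the trace identity
  gives l tau(P) = tau(P y). The right side is the squared norm of P times the invertible root of
  \<open>y\<close>, hence positive.\<close>

lemma E_posdef:
  assumes y: "y \<in> M" "posdef y"
  shows "posdef (E y)"
proof -
  have h: "hermitian (E y)" using assms by (intro E_hermitian posdef_hermitian)
  have EN: "E y \<in> N" by (rule E_in[OF y(1)])
  have "0 < l" if l: "l \<in> spec (E y)" for l
  proof -
    define P where "P = eigproj (E y) l"
    have P: "P \<noteq> 0" "P \<in> N" "adj P = P" "P ** P = P" "P ** E y = cscale (of_real l) P"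
      using l h EN unfolding P_def
      by (simp_all add: spec_def adj_eigproj eigproj_mult eigproj_mult_self)
    have PP: "0 < Re (tau P)" using tau_adj_mult_pos[of P] P by simp
    have "of_real l * tau P = tau (P ** y)"
      using P EN y(1) by (metis tau_E tau_cscale in_M)
    also have "\<dots> = of_real ((gns_norm y P)\<^sup>2)"
      using gns_norm_sq(2)[OF y, of P] P by simp
    finally have "Re (of_real l * tau P) = Re (of_real ((gns_norm y P)\<^sup>2))" by (rule arg_cong)
    then have lP: "l * Re (tau P) = (gns_norm y P)\<^sup>2" by (simp del: of_real_power)
    have "P ** mpow y (1/2) \<noteq> 0"
    proof
      assume "P ** mpow y (1/2) = 0"
      then have "P ** mpow y (1/2) ** mpow y (-1/2) = 0" by simp
      then show False
        using mpow_add[OF y(2), of "1/2" "-1/2"] P(1)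
        by (simp add: mpow_0 y flip: matrix_mul_assoc)
    qed
    then have "0 < (gns_norm y P)\<^sup>2"
      using tau_adj_mult_pos[of "P ** mpow y (1/2)"] P y
      by (simp add: gns_norm_def hs_norm_sq)
    then show ?thesis using PP lP by (metis zero_less_mult_pos2)
  qed
  then show ?thesis using h by (simp add: posdef_def)
qed

end

section \<open>Integral representations of powers and of the logarithm\<close>

text \<open>The function u^(z - 1) on the positive half-line, extended by 0 so that Bochner
  integrals run over all reals; the \<open>exp\<close>-\<open>ln\<close> form makes measurability
  immediate.\<close>

definition mellin_kernel :: "complex \<Rightarrow> real \<Rightarrow> complex" where
  "mellin_kernel z u = indicator {0<..} u *\<^sub>R exp ((z - 1) * of_real (ln u))"

lemma mellin_kernel_pos: "0 < u \<Longrightarrow> mellin_kernel z u = of_real u powr (z - 1)"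
  and mellin_kernel_nonpos: "u \<le> 0 \<Longrightarrow> mellin_kernel z u = 0"
  by (simp_all add: mellin_kernel_def powr_def Ln_of_real)

lemma borel_measurable_mellin_kernel [measurable]: "mellin_kernel z \<in> borel_measurable borel"
  unfolding mellin_kernel_def by measurable

lemma mellin_kernel_mult:
  "0 < r \<Longrightarrow> mellin_kernel z (r * u) = of_real r powr (z - 1) * mellin_kernel z u"
  by (auto simp: mellin_kernel_def ln_mult powr_def Ln_of_real distrib_left exp_add indicator_def
      zero_less_mult_iff)

lemma norm_mellin_kernel: "of_real (norm (mellin_kernel z u)) = mellin_kernel (of_real (Re z)) u"
  by (simp add: mellin_kernel_def indicator_def flip: exp_of_real)

text \<open>Absolute integrability turns the gauge integral of Gamma into a Bochner integral, the
  form on which Fubini and the affine substitution operate.\<close>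

lemma has_bochner_integral_Gamma:
  assumes "Re z > 0"
  shows "has_bochner_integral lborel (\<lambda>u. mellin_kernel z u * of_real (exp (- u))) (Gamma z)"
proof -
  let ?f = "\<lambda>t. complex_of_real t powr (z - 1) / of_real (exp t)"
  let ?g = "\<lambda>u. mellin_kernel z u * of_real (exp (- u))"
  have g: "?g = (\<lambda>u. indicator {0<..} u *\<^sub>R ?f u)"
    by (auto simp: fun_eq_iff indicator_def mellin_kernel_pos mellin_kernel_nonpos exp_minus field_simps)
  have m: "?g \<in> borel_measurable lborel" by measurable
  have ai: "set_integrable lebesgue {0<..} ?f"
    by (rule absolutely_integrable_Gamma_integral'[OF assms])
  then have "integrable lebesgue ?g" unfolding g set_integrable_def .
  then have int: "integrable lborel ?g" using integrable_completion[OF m] by simp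
  have "(?g has_integral Gamma z) UNIV"
  proof -
    have "?g = (\<lambda>u. if u \<in> {0<..} then ?f u else 0)"
      unfolding g by (auto simp: indicator_def)
    then show ?thesis
      using Gamma_integral_complex'[OF assms] by (simp only: has_integral_restrict_UNIV)
  qed
  moreover have "(?g has_integral integral\<^sup>L lborel ?g) UNIV"
    by (rule has_integral_integral_lborel[OF int])
  ultimately have "integral\<^sup>L lborel ?g = Gamma z" by (rule has_integral_unique[rotated])
  then show ?thesis using int by (simp add: has_bochner_integral_iff)
qed

lemma has_bochner_integral_Gamma_scaled:
  assumes "Re z > 0" "r > 0"
  shows "has_bochner_integral lborel (\<lambda>u. mellin_kernel z u * of_real (exp (- r * u)))
    (Gamma z * of_real r powr (- z))"
proof -
  have "has_bochner_integral lborel (\<lambda>u. mellin_kernel z (0 + r * u) * of_real (exp (- (0 + r * u))))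
    (Gamma z /\<^sub>R \<bar>r\<bar>)"
    using lborel_has_bochner_integral_real_affine_iff[of r "\<lambda>u. mellin_kernel z u * of_real (exp (- u))"
        "Gamma z" 0] has_bochner_integral_Gamma[OF assms(1)] assms(2) by simp
  then have "has_bochner_integral lborel (\<lambda>u. of_real r powr (1 - z) *
      (of_real r powr (z - 1) * mellin_kernel z u * of_real (exp (- r * u))))
      (of_real r powr (1 - z) * (Gamma z / of_real r))"
    using assms(2) mellin_kernel_mult[OF assms(2), of z] by (intro has_bochner_integral_mult_right)
      (simp add: scaleR_conv_of_real divide_inverse mult.commute[of "Gamma z"])
  moreover have "complex_of_real r powr (1 - z) * of_real r powr (z - 1) = 1"
    using assms(2) by (simp flip: powr_add)
  moreover have "complex_of_real r powr (1 - z) * (Gamma z / of_real r) = Gamma z * of_real r powr (- z)"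
    using assms(2) powr_diff[of "complex_of_real r" "1 - z" 1] by simp
  ultimately show ?thesis
    by (simp only: mult.assoc[symmetric] mult_1_left)
qed

text \<open>Fubini applied to \<open>u powr (z - 1) * exp (- r * (1 + u))\<close>: integrating over \<open>u\<close> first gives the
  integrand of \<open>Gamma z * Gamma (1 - z)\<close>, integrating over \<open>r\<close> first gives \<open>u powr (z - 1) / (1 + u)\<close>.\<close>

lemma has_bochner_integral_mellin:
  assumes z: "0 < Re z" "Re z < 1"
  shows "has_bochner_integral lborel (\<lambda>u. mellin_kernel z u / of_real (1 + u)) (Gamma z * Gamma (1 - z))"
proof -
  \<comment> \<open>\<open>mellin_kernel 1 r\<close> is 1 for positive \<open>r\<close> and 0
    otherwise: it only restricts the second variable to the half-line.\<close>
  define f where "f r u = mellin_kernel z u * (mellin_kernel 1 r * of_real (exp (- r * (1 + u))))" for r u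
  have f_alt: "f r u = (mellin_kernel 1 r * of_real (exp (- r))) * (mellin_kernel z u * of_real (exp (- r * u)))"
    for r u
  proof -
    have "exp (- r * (1 + u)) = exp (- r) * exp (- r * u)" by (simp add: distrib_left flip: exp_add)
    then show ?thesis by (simp add: f_def)
  qed
  have [measurable]: "(\<lambda>(r, u). f r u) \<in> borel_measurable (lborel \<Otimes>\<^sub>M lborel)"
    unfolding f_def by measurable
  have inner_u: "has_bochner_integral lborel (f r) (Gamma z * (mellin_kernel (1 - z) r * of_real (exp (- r))))"
    for r
  proof (cases "r > 0")
    case True
    have "has_bochner_integral lborel (f r) ((mellin_kernel 1 r * of_real (exp (- r))) *
        (Gamma z * of_real r powr (- z)))"
      unfolding f_alt by (intro has_bochner_integral_mult_right has_bochner_integral_Gamma_scaled z True)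
    then show ?thesis using True by (simp add: mellin_kernel_pos mult_ac)
  next
    case False
    then have "f r = (\<lambda>u. 0)" by (simp add: fun_eq_iff f_def mellin_kernel_nonpos)
    then show ?thesis using False
      by (simp add: mellin_kernel_nonpos has_bochner_integral_zero)
  qed
  have inner_r: "(\<integral>r. f r u \<partial>lborel) = mellin_kernel z u / of_real (1 + u)" for u
  proof (cases "u > 0")
    case True
    have "has_bochner_integral lborel (\<lambda>r. mellin_kernel z u * (mellin_kernel 1 r * of_real (exp (- (1 + u) * r))))
        (mellin_kernel z u * (Gamma 1 * of_real (1 + u) powr (- 1)))"
      by (intro has_bochner_integral_mult_right has_bochner_integral_Gamma_scaled) (use True in auto)
    moreover have "- (1 + u) * r = - r * (1 + u)" for r by (simp add: algebra_simps)
    ultimately have "has_bochner_integral lborel (\<lambda>r. f r u) (mellin_kernel z u / of_real (1 + u))"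
      using True by (simp only: f_def) (simp add: powr_minus divide_inverse)
    then show ?thesis by (rule has_bochner_integral_integral_eq)
  qed (simp add: f_def mellin_kernel_nonpos)
  have norm_f: "norm (f r u) = norm (mellin_kernel 1 r * of_real (exp (- r))) *
      norm (mellin_kernel z u * of_real (exp (- r * u)))" for r u
    by (simp add: f_alt norm_mult)
  \<comment> \<open>The modulus of the kernel is the kernel with exponent \<open>Re z\<close>, so
    the norms integrate to the same formula at a real parameter. Its integrability in
    \<open>r\<close>, from \<open>Re z < 1\<close>, is the hypothesis of Fubini.\<close>
  have norm_int: "(\<integral>u. norm (f r u) \<partial>lborel) =
      Re (Gamma (of_real (Re z)) * (mellin_kernel (of_real (1 - Re z)) r * of_real (exp (- r))))" for r
  proof (cases "r > 0")
    case True
    have "has_bochner_integral lborel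
        (\<lambda>u. Re (mellin_kernel (of_real (Re z)) u * of_real (exp (- r * u))))
        (Re (Gamma (of_real (Re z)) * of_real r powr (- of_real (Re z))))"
      by (intro has_bochner_integral_bounded_linear[OF bounded_linear_Re]
          has_bochner_integral_Gamma_scaled) (use z True in auto)
    moreover have "Re (mellin_kernel (of_real (Re z)) u * of_real (exp (- r * u))) =
       norm (mellin_kernel z u * of_real (exp (- r * u)))" for u
      by (simp add: norm_mult flip: norm_mellin_kernel)
    ultimately have "(\<integral>u. norm (mellin_kernel z u * of_real (exp (- r * u))) \<partial>lborel) =
        Re (Gamma (of_real (Re z)) * of_real r powr (- of_real (Re z)))"
      by (simp add: has_bochner_integral_iff)
    then show ?thesis using True
      unfolding norm_f by (simp add: mellin_kernel_pos norm_mult mult_ac right_diff_distrib)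
  qed (simp add: f_def mellin_kernel_nonpos)
  have "integrable lborel (\<lambda>r. \<integral>u. norm (f r u) \<partial>lborel)"
    unfolding norm_int
    using has_bochner_integral_Gamma[of "of_real (1 - Re z)"] z
    by (intro integrable_bounded_linear[OF bounded_linear_Re] integrable_mult_right)
      (auto simp: has_bochner_integral_iff)
  then have int: "integrable (lborel \<Otimes>\<^sub>M lborel) (\<lambda>(r, u). f r u)"
    by (intro lborel_pair.Fubini_integrable)
      (use inner_u in \<open>auto simp: has_bochner_integral_iff\<close>)
  have "(\<integral>u. (\<integral>r. f r u \<partial>lborel) \<partial>lborel) = (\<integral>r. (\<integral>u. f r u \<partial>lborel) \<partial>lborel)"
    by (rule lborel_pair.Fubini_integral[OF int])
  also have "\<dots> = (\<integral>r. Gamma z * (mellin_kernel (1 - z) r * of_real (exp (- r))) \<partial>lborel)"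
    using inner_u by (simp add: has_bochner_integral_iff)
  also have "\<dots> = Gamma z * Gamma (1 - z)"
    using has_bochner_integral_Gamma[of "1 - z"] z by (simp add: has_bochner_integral_iff)
  finally have "(\<integral>u. mellin_kernel z u / of_real (1 + u) \<partial>lborel) = Gamma z * Gamma (1 - z)"
    unfolding inner_r .
  moreover have "integrable lborel (\<lambda>u. mellin_kernel z u / of_real (1 + u))"
    using lborel_pair.integrable_snd[OF int] unfolding inner_r .
  ultimately show ?thesis by (simp add: has_bochner_integral_iff)
qed

text \<open>Substituting u = s / x in the Mellin integral, since s^z (1 / s - 1 / (s + x)) = s^(z -
  1) / (1 + s / x). The constant is the reflection formula pi / sin(pi z), and sin(pi (1/2 + i t)) =
  cosh(pi t).\<close>

lemma has_integral_powr_resolvent: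
  assumes x: "x > 0"
  defines "z \<equiv> \<lambda>t. 1/2 + \<i> * complex_of_real t"
  shows "((\<lambda>s. of_real s powr (z t) * (1 / of_real s - 1 / of_real (s + x))) has_integral
    of_real (pi / cosh (pi * t)) * of_real x powr (z t)) {0<..}"
proof -
  let ?g = "\<lambda>u. mellin_kernel (z t) u / of_real (1 + u)"
  have refl: "Gamma (z t) * Gamma (1 - z t) = of_real (pi / cosh (pi * t))"
  proof -
    have "sin (of_real pi * z t) = cos (- (\<i> * of_real (pi * t)))"
      by (simp add: sin_cos_eq z_def algebra_simps)
    also have "\<dots> = of_real (cosh (pi * t))"
      by (simp add: cosh_conv_cos cosh_def scaleR_conv_of_real cos_exp_eq exp_of_real[symmetric])
    finally show ?thesis by (simp add: Gamma_reflection_complex)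
  qed
  have "has_bochner_integral lborel ?g (of_real (pi / cosh (pi * t)))"
    using has_bochner_integral_mellin[of "z t"] unfolding refl by (simp add: z_def)
  then have "has_bochner_integral lborel (\<lambda>s. ?g (0 + (1/x) * s)) (of_real (pi / cosh (pi * t)) /\<^sub>R \<bar>1/x\<bar>)"
    using lborel_has_bochner_integral_real_affine_iff[of "1/x" ?g _ 0] x by simp
  then have "((\<lambda>s. ?g ((1/x) * s)) has_integral x *\<^sub>R of_real (pi / cosh (pi * t))) UNIV"
    using has_integral_integral_lborel x by (fastforce simp: has_bochner_integral_iff)
  then have "((\<lambda>s. of_real x powr (z t - 1) * ?g ((1/x) * s)) has_integral
      of_real x powr (z t - 1) * (x *\<^sub>R of_real (pi / cosh (pi * t)))) UNIV"
    by (rule has_integral_mult_right)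
  also have "of_real x powr (z t - 1) * (x *\<^sub>R of_real (pi / cosh (pi * t))) =
      of_real (pi / cosh (pi * t)) * of_real x powr (z t)"
    using x by (simp add: powr_diff scaleR_conv_of_real)
  also have "(\<lambda>s. of_real x powr (z t - 1) * ?g ((1/x) * s)) =
     (\<lambda>s. if s \<in> {0<..} then of_real s powr (z t) * (1 / of_real s - 1 / of_real (s + x)) else 0)"
  proof
    fix s :: real
    show "of_real x powr (z t - 1) * ?g ((1/x) * s) =
      (if s \<in> {0<..} then of_real s powr (z t) * (1 / of_real s - 1 / of_real (s + x)) else 0)"
    proof (cases "s > 0")
      case True
      have "of_real x powr (z t - 1) * (of_real (1/x) powr (z t - 1)) = (1::complex)"
        using x by (simp add: powr_def Ln_of_real ln_div algebra_simps flip: exp_add del: of_real_divide)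
      then have "of_real x powr (z t - 1) * mellin_kernel (z t) ((1/x) * s) = of_real s powr (z t - 1)"
        using x True by (subst mellin_kernel_mult) (simp_all add: mellin_kernel_pos flip: mult.assoc)
      then have "of_real x powr (z t - 1) * ?g ((1/x) * s) = of_real s powr (z t - 1) / of_real (1 + s / x)"
        by simp
      also have "\<dots> = of_real s powr (z t) * (1 / of_real s - 1 / of_real (s + x))"
      proof -
        have "complex_of_real s \<noteq> 0" "complex_of_real x \<noteq> 0" "complex_of_real s + complex_of_real x \<noteq> 0"
          using x True by (simp_all flip: of_real_add)
        then show ?thesis by (simp add: powr_diff field_simps)
      qed
      finally show ?thesis using True by simp
    next
      case False
      then show ?thesis using x by (simp add: mellin_kernel_nonpos divide_le_0_iff)
    qed
  qed
  finally show ?thesis unfolding has_integral_restrict_UNIV .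
qed

lemma has_integral_Ioi_iff:
  fixes f :: "real \<Rightarrow> 'a::banach"
  shows "(f has_integral I) {a<..} \<longleftrightarrow> (f has_integral I) {a..}"
  by (rule has_integral_spike_set_eq) (auto intro: negligible_subset[of "{a}"])

text \<open>The primitive is ln((s + a) / (s + b)). Passing to infinity uses a nonnegative
  integrand, so the parameters are ordered first and the case \<open>x > 1\<close> follows by
  negation.\<close>

lemma has_integral_ln_resolvent:
  fixes x :: real
  assumes x: "x > 0"
  shows "((\<lambda>s. 1 / (s + x) - 1 / (s + 1)) has_integral (- ln x)) {0..}"
proof -
  have main: "((\<lambda>s. 1 / (s + a) - 1 / (s + b)) has_integral (ln b - ln a)) {0..}"
    if ab: "0 < a" "a \<le> b" for a b :: real
  proof (rule has_integral_to_inf)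
    let ?F = "\<lambda>s. ln (s + a) - ln (s + b)"
    have *: "((\<lambda>s. 1 / (s + a) - 1 / (s + b)) has_integral (?F y - ?F 0)) {0..y}" if "0 \<le> y" for y
      using that ab
      by (intro fundamental_theorem_of_calculus)
        (auto intro!: derivative_eq_intros simp: divide_inverse simp flip: has_real_derivative_iff_has_vector_derivative)
    show "(\<lambda>s. 1 / (s + a) - 1 / (s + b)) integrable_on {0..y}" for y
      using *[of y] by (cases "0 \<le> y") auto
    have "((\<lambda>y. ?F y - ?F 0) \<longlongrightarrow> ln b - ln a) at_top"
      using ab by real_asymp
    moreover have "\<forall>\<^sub>F y in at_top. ?F y - ?F 0 = integral {0..y} (\<lambda>s. 1 / (s + a) - 1 / (s + b))"
      using eventually_ge_at_top[of 0] by eventually_elim (rule integral_unique[OF *, symmetric])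
    ultimately show "((\<lambda>y. integral {0..y} (\<lambda>s. 1 / (s + a) - 1 / (s + b))) \<longlongrightarrow> ln b - ln a) at_top"
      by (rule Lim_transform_eventually)
    show "0 \<le> 1 / (y + a) - 1 / (y + b)" if "0 \<le> y" for y
      using that ab by (simp add: frac_le)
  qed
  show ?thesis
  proof (cases "x \<le> 1")
    case True
    then show ?thesis using main[of x 1] x by simp
  next
    case False
    then show ?thesis using has_integral_neg[OF main[of 1 x]] x by simp
  qed
qed

section \<open>Two-variable functional calculus\<close>

text \<open>\<open>bifun (\<lambda>q p. h (q / p)) s r\<close> is \<open>h(\<Delta>)\<close> applied to the identity, where \<open>\<Delta>\<close> is the relative
  modular operator \<open>x \<mapsto> s x r\<^sup>-\<^sup>1\<close>.\<close>

definition bifun :: "(real \<Rightarrow> real \<Rightarrow> complex) \<Rightarrow> 'n::finite cmat \<Rightarrow> 'n cmat \<Rightarrow> 'n cmat" where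
  "bifun h s r = (\<Sum>q\<in>spec s. \<Sum>p\<in>spec r. cscale (h q p) (eigproj s q ** eigproj r p))"

lemma bifun_cong:
  "(\<And>q p. q \<in> spec s \<Longrightarrow> p \<in> spec r \<Longrightarrow> h q p = g q p) \<Longrightarrow> bifun h s r = bifun g s r"
  by (simp add: bifun_def)

lemma bifun_add: "bifun h s r + bifun g s r = bifun (\<lambda>q p. h q p + g q p) s r"
  and bifun_diff: "bifun h s r - bifun g s r = bifun (\<lambda>q p. h q p - g q p) s r"
  and cscale_bifun: "cscale c (bifun h s r) = bifun (\<lambda>q p. c * h q p) s r"
  by (simp_all add: bifun_def sum.distrib sum_subtractf cscale_add_left cscale_diff_left cscale_sum_right)

context
  fixes s r :: "'n::finite cmat"
  assumes s: "hermitian s" and r: "hermitian r"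
begin

lemma matfun_bifun: "matfun f s ** bifun h s r = bifun (\<lambda>q p. f q * h q p) s r"
  by (simp add: bifun_def matmul_sum_right matrix_mul_assoc matfun_eigproj[OF s] mult.commute)

lemma bifun_matfun: "bifun h s r ** matfun f r = bifun (\<lambda>q p. h q p * f p) s r"
  by (simp add: bifun_def matmul_sum_left eigproj_matfun[OF r] flip: matrix_mul_assoc)

lemma bifun_one: "bifun (\<lambda>q p. 1) s r = mat 1"
  by (simp add: bifun_def sum_eigproj[OF r] sum_eigproj[OF s]
      flip: matmul_sum_right matmul_sum_left)

lemma bifun_left: "bifun (\<lambda>q p. f q) s r = matfun f s"
  using matfun_bifun[of f "\<lambda>q p. 1"] by (simp add: bifun_one)

lemma bifun_right: "bifun (\<lambda>q p. f p) s r = matfun f r"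
  using bifun_matfun[of "\<lambda>q p. 1" f] by (simp add: bifun_one)

lemma bifun_prod: "bifun (\<lambda>q p. f q * g p) s r = matfun f s ** matfun g r"
  using bifun_matfun[of "\<lambda>q p. f q" g] by (simp add: bifun_left)

lemma eigproj_bifun_eigproj:
  assumes "q \<in> spec s" "p \<in> spec r"
  shows "eigproj s q ** bifun h s r ** eigproj r p = cscale (h q p) (eigproj s q ** eigproj r p)"
proof -
  have "eigproj s q ** bifun h s r ** eigproj r p =
      (\<Sum>q'\<in>spec s. \<Sum>p'\<in>spec r. cscale (h q' p')
        ((eigproj s q ** eigproj s q') ** (eigproj r p' ** eigproj r p)))"
    by (simp add: bifun_def matmul_sum_right matmul_sum_left matrix_mul_assoc)
  also have "\<dots> = (\<Sum>q'\<in>spec s. \<Sum>p'\<in>spec r. if p' = p \<and> q' = q then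
        cscale (h q p) (eigproj s q ** eigproj r p) else 0)"
    by (intro sum.cong refl) (auto simp: eigproj_mult[OF s] eigproj_mult[OF r])
  also have "\<dots> = (\<Sum>q'\<in>spec s. if q' = q then cscale (h q p) (eigproj s q ** eigproj r p) else 0)"
    using assms finite_spec[OF r] by (intro sum.cong refl) auto
  also have "\<dots> = cscale (h q p) (eigproj s q ** eigproj r p)"
    using assms finite_spec[OF s] by simp
  finally show ?thesis .
qed

end

context
  fixes s r :: "'n::finite cmat"
  assumes s: "posdef s" and r: "posdef r"
begin

lemma bifun_cong_pos:
  "(\<And>q p. 0 < q \<Longrightarrow> 0 < p \<Longrightarrow> h q p = g q p) \<Longrightarrow> bifun h s r = bifun g s r"
  by (rule bifun_cong) (use s r in \<open>auto simp: posdef_def\<close>)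

lemma bifun_powr: "bifun (\<lambda>q p. of_real (q / p) powr z) s r = mpow s z ** mpow r (- z)"
  unfolding mpow_def bifun_prod[OF posdef_hermitian[OF s] posdef_hermitian[OF r], symmetric]
  by (rule bifun_cong_pos) (auto simp: powr_def Ln_of_real ln_div algebra_simps simp del: of_real_divide simp flip: exp_add)

lemma bifun_ln: "bifun (\<lambda>q p. of_real (- ln (q / p))) s r = mlog r - mlog s"
proof -
  note h = posdef_hermitian[OF s] posdef_hermitian[OF r]
  show ?thesis
    unfolding mlog_def bifun_left[OF h, symmetric] bifun_right[OF h, symmetric] bifun_diff
    by (rule bifun_cong_pos) (simp add: ln_div)
qed

lemma bifun_ratio: "bifun (\<lambda>q p. of_real (q / p)) s r = s ** mpow r (- 1)"
proof -
  have "bifun (\<lambda>q p. of_real (q / p)) s r = bifun (\<lambda>q p. of_real (q / p) powr 1) s r"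
    by (rule bifun_cong_pos) simp
  then show ?thesis by (simp only: bifun_powr mpow_1[OF s])
qed

text \<open>The vector (t + Delta)^(-1) 1.\<close>

definition resolvent :: "real \<Rightarrow> 'n cmat" where
  "resolvent t = bifun (\<lambda>q p. of_real (1 / (t + q / p))) s r"

text \<open>The equation (t + Delta) x = 1 multiplied by \<open>r\<close> from the right. Free of
  inverses, it can be tested under the trace against elements of both algebras.\<close>

lemma resolvent_eq:
  assumes "0 < t"
  shows "cscale (of_real t) (resolvent t ** r) + s ** resolvent t = r"
proof -
  note h = posdef_hermitian[OF s] posdef_hermitian[OF r]
  have 1: "resolvent t ** r = bifun (\<lambda>q p. of_real (1 / (t + q / p)) * of_real p) s r"
    using bifun_matfun[OF h, of _ complex_of_real] by (simp add: resolvent_def matfun_id h)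
  have 2: "s ** resolvent t = bifun (\<lambda>q p. of_real q * of_real (1 / (t + q / p))) s r"
    using matfun_bifun[OF h, of complex_of_real] by (simp add: resolvent_def matfun_id h)
  have 3: "r = bifun (\<lambda>q p. of_real p) s r"
    using bifun_right[OF h, of complex_of_real] by (simp add: matfun_id h)
  show ?thesis
    unfolding 1 2 cscale_bifun bifun_add
  proof (subst 3, rule bifun_cong_pos)
    fix q p :: real assume qp: "0 < q" "0 < p"
    have pos: "0 < t * p + q" using assms qp by (simp add: add_pos_pos)
    have "t * (1 / (t + q / p) * p) + q * (1 / (t + q / p)) = p"
    proof -
      have "1 / (t + q / p) = p / (t * p + q)" using qp pos by (simp add: field_simps)
      then have "t * (1 / (t + q / p) * p) + q * (1 / (t + q / p)) = (t * p + q) * (p / (t * p + q))"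
        by (simp add: algebra_simps add_divide_distrib)
      then show ?thesis using pos by simp
    qed
    then show "complex_of_real t * (of_real (1 / (t + q / p)) * of_real p) +
        of_real q * of_real (1 / (t + q / p)) = of_real p"
      by (simp only: flip: of_real_mult of_real_add)
  qed
qed

end

context trace_algebra
begin

context
  fixes s r assumes s: "s \<in> M" "posdef s" and r: "r \<in> M" "posdef r"
begin

lemma bifun_in [simp, intro]: "bifun h s r \<in> M"
  unfolding bifun_def using s r
  by (intro sum_in cscale_in mult_in eigproj_in posdef_hermitian)

text \<open>Outside \<open>M\<close> nothing is known about \<open>tau\<close>, so the integral is
  not pulled through it directly: the expression is a finite sum of scalar integrals with fixed
  trace coefficients.\<close>

lemma bifun_has_integral:
  fixes k :: "'b::euclidean_space \<Rightarrow> real \<Rightarrow> real \<Rightarrow> complex"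
  assumes "b \<in> M" "c \<in> M"
    and "\<And>q p. 0 < q \<Longrightarrow> 0 < p \<Longrightarrow> ((\<lambda>t. k t q p) has_integral I q p) S"
  shows "((\<lambda>t. tau (b ** bifun (k t) s r ** c)) has_integral tau (b ** bifun I s r ** c)) S"
proof -
  have exp: "tau (b ** bifun h s r ** c) =
      (\<Sum>q\<in>spec s. \<Sum>p\<in>spec r. h q p * tau (b ** (eigproj s q ** eigproj r p) ** c))" for h
  proof -
    have e: "eigproj s q ** eigproj r p \<in> M" for q p
      using s r by (intro mult_in eigproj_in posdef_hermitian)
    have "b ** bifun h s r ** c =
       (\<Sum>q\<in>spec s. \<Sum>p\<in>spec r. cscale (h q p) (b ** (eigproj s q ** eigproj r p) ** c))"
      by (simp add: bifun_def matmul_sum_right matmul_sum_left)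
    then show ?thesis using assms(1,2) e
      by (simp add: tau_sum sum_in tau_cscale)
  qed
  show ?thesis
    unfolding exp
    by (intro has_integral_sum has_integral_mult_left assms(3) finite_spec)
      (use s r in \<open>auto simp: posdef_def\<close>)
qed

text \<open>By cyclicity this is tau(adj a a) for a the product of the two projections. These
  numbers are the joint spectral weights of the pair.\<close>

lemma tau_eigproj_mult:
  "0 \<le> Re (tau (eigproj s q ** eigproj r p))" "Im (tau (eigproj s q ** eigproj r p)) = 0"
proof -
  let ?a = "eigproj s q ** eigproj r p"
  have h: "hermitian s" "hermitian r" using s r by (auto simp: posdef_def)
  have e: "eigproj s q \<in> M" "eigproj r p \<in> M" using s r h by auto
  have "tau (adj ?a ** ?a) = tau (eigproj r p ** (eigproj s q ** eigproj s q) ** eigproj r p)"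
    by (simp add: adj_mult adj_eigproj h matrix_mul_assoc)
  also have "\<dots> = tau (eigproj r p ** eigproj s q ** eigproj r p)"
    by (simp add: eigproj_mult h)
  also have "\<dots> = tau (eigproj r p ** eigproj r p ** eigproj s q)"
    using e by (intro tau_cycle)
  also have "\<dots> = tau (eigproj s q ** eigproj r p)"
    using e by (simp add: eigproj_mult h tau_commute)
  finally show "0 \<le> Re (tau ?a)" "Im (tau ?a) = 0"
    using tau_adj_mult[of ?a] e by auto
qed

text \<open>Parseval: products of spectral projections for different pairs (q, p) are orthogonal in
  the GNS space, with squared norm p times the joint weight.\<close>

lemma gns_norm_bifun_sq:
  "(gns_norm r (bifun h s r))\<^sup>2 =
    (\<Sum>q\<in>spec s. \<Sum>p\<in>spec r. (cmod (h q p))\<^sup>2 * (p * Re (tau (eigproj s q ** eigproj r p))))"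
proof -
  let ?e = "\<lambda>q p. eigproj s q ** eigproj r p"
  have h: "hermitian s" "hermitian r" using s r by (auto simp: posdef_def)
  have e: "eigproj s q \<in> M" "eigproj r p \<in> M" for q p using s r h by auto
  have "tau (adj (bifun h s r) ** bifun h s r ** r) =
    tau (adj (bifun h s r) ** bifun (\<lambda>q p. h q p * of_real p) s r)"
    using bifun_matfun[OF h, of h complex_of_real] by (simp add: matfun_id h flip: matrix_mul_assoc)
  also have "\<dots> = (\<Sum>q\<in>spec s. \<Sum>p\<in>spec r. cnj (h q p) *
      tau (eigproj r p ** eigproj s q ** bifun (\<lambda>q p. h q p * of_real p) s r))"
  proof -
    have "adj (bifun h s r) = (\<Sum>q\<in>spec s. \<Sum>p\<in>spec r. cscale (cnj (h q p)) (eigproj r p ** eigproj s q))"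
      by (simp add: bifun_def adj_sum adj_cscale adj_mult adj_eigproj h)
    then show ?thesis using e by (simp add: matmul_sum_left tau_sum sum_in tau_cscale)
  qed
  also have "\<dots> = (\<Sum>q\<in>spec s. \<Sum>p\<in>spec r. cnj (h q p) * (h q p * of_real p * tau (?e q p)))"
  proof (intro sum.cong refl)
    fix q p assume qp: "q \<in> spec s" "p \<in> spec r"
    let ?b = "bifun (\<lambda>q p. h q p * of_real p) s r"
    have "tau (eigproj r p ** eigproj s q ** ?b) = tau (eigproj s q ** ?b ** eigproj r p)"
      using tau_cycle[OF e(1) bifun_in e(2)] by simp
    also have "\<dots> = h q p * of_real p * tau (?e q p)"
      unfolding eigproj_bifun_eigproj[OF h qp] using e by (simp add: tau_cscale)
    finally show "cnj (h q p) * tau (eigproj r p ** eigproj s q ** ?b) =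
      cnj (h q p) * (h q p * of_real p * tau (?e q p))" by simp
  qed
  also have "Re \<dots> = (\<Sum>q\<in>spec s. \<Sum>p\<in>spec r. (cmod (h q p))\<^sup>2 * (p * Re (tau (?e q p))))"
  proof -
    have *: "cnj (h q p) * (h q p * of_real p * tau (?e q p)) =
        of_real ((cmod (h q p))\<^sup>2) * (of_real p * tau (?e q p))" for q p
      by (simp only: complex_norm_square mult_ac)
    have "Re (cnj (h q p) * (h q p * of_real p * tau (?e q p))) =
        (cmod (h q p))\<^sup>2 * (p * Re (tau (?e q p)))" for q p
      unfolding * by (simp del: of_real_power)
    then show ?thesis by simp
  qed
  finally show ?thesis using gns_norm_sq[OF r bifun_in] by simp
qed

lemma gns_norm_bifun_mono:
  assumes "\<And>q p. 0 < q \<Longrightarrow> 0 < p \<Longrightarrow> cmod (h q p) \<le> C * cmod (g q p)" and "0 \<le> C"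
  shows "gns_norm r (bifun h s r) \<le> C * gns_norm r (bifun g s r)"
proof (rule power2_le_imp_le)
  have "(gns_norm r (bifun h s r))\<^sup>2 \<le>
      (\<Sum>q\<in>spec s. \<Sum>p\<in>spec r. (C * cmod (g q p))\<^sup>2 * (p * Re (tau (eigproj s q ** eigproj r p))))"
    unfolding gns_norm_bifun_sq
  proof (intro sum_mono mult_right_mono power_mono)
    fix q p assume "q \<in> spec s" "p \<in> spec r"
    then have qp: "0 < q" "0 < p" using s r by (auto simp: posdef_def)
    show "cmod (h q p) \<le> C * cmod (g q p)" using assms(1) qp .
    show "0 \<le> p * Re (tau (eigproj s q ** eigproj r p))" using qp tau_eigproj_mult by simp
  qed simp
  also have "\<dots> = (C * gns_norm r (bifun g s r))\<^sup>2"
    by (simp add: power_mult_distrib gns_norm_bifun_sq sum_distrib_left mult.assoc)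
  finally show "(gns_norm r (bifun h s r))\<^sup>2 \<le> (C * gns_norm r (bifun g s r))\<^sup>2" .
  show "0 \<le> C * gns_norm r (bifun g s r)"
    using assms(2) gns_norm_ge_0[OF r bifun_in] by simp
qed

lemma rel_ent_eq_bifun: "rel_ent tau r s = Re (tau (bifun (\<lambda>q p. of_real (- ln (q / p))) s r ** r))"
proof -
  have m: "mlog s \<in> M" "mlog r \<in> M"
    unfolding mlog_def using s r star_subalg by (auto intro!: matfun_in_star_subalg simp: posdef_def)
  then show ?thesis
    using s r unfolding rel_ent_def bifun_ln[OF s(2) r(2)] matmul_diff_left
    by (simp add: tau_diff tau_commute)
qed

text \<open>Identifies \<open>Qx2\<close> with |Delta 1|^2, because Delta 1 is
  \<open>s ** mpow r (- 1)\<close>. In this role it controls the resolvent at large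
  parameters.\<close>

lemma Qx2_eq_gns_norm: "Qx2 tau r s = (gns_norm r (s ** mpow r (- 1)))\<^sup>2"
proof -
  let ?i = "mpow r (- 1)"
  have i: "adj ?i = ?i" "?i ** r = mat 1" "?i \<in> M"
    using r adj_mpow[OF r(2), of "- 1"] mpow_add[OF r(2), of "- 1" 1] by (auto simp: mpow_1 mpow_0)
  have "adj (s ** ?i) ** (s ** ?i) ** r = ?i ** s ** s ** (?i ** r)"
    using posdef_hermitian[OF s(2)] by (simp add: adj_mult i(1,3) hermitian_def matrix_mul_assoc)
  then show ?thesis
    using gns_norm_sq(1)[OF r, of "s ** ?i"] s i
    by (simp add: Qx2_def matrix_inv_posdef r)
qed

lemma resolvent_in [simp, intro]: "resolvent s r t \<in> M"
  unfolding resolvent_def[OF s(2) r(2)] by simp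

text \<open>The scalar bound |1 / (t + x) - 1 / t| <= x / t^2 at x = q / p. The subtracted multiple
  of the identity is common to both algebras and cancels in their difference.\<close>

lemma gns_norm_resolvent_le:
  assumes "0 < t"
  shows "gns_norm r (resolvent s r t - cscale (1 / of_real t) (mat 1)) \<le> sqrt (Qx2 tau r s) / t\<^sup>2"
proof -
  have h: "hermitian s" "hermitian r" using s r by (auto simp: posdef_def)
  have eq: "resolvent s r t - cscale (1 / of_real t) (mat 1) =
      bifun (\<lambda>q p. of_real (1 / (t + q / p) - 1 / t)) s r"
    unfolding resolvent_def[OF s(2) r(2)] bifun_one[OF h, symmetric] cscale_bifun bifun_diff
    by simp
  have "gns_norm r (bifun (\<lambda>q p. of_real (1 / (t + q / p) - 1 / t)) s r) \<le>
      1 / t\<^sup>2 * gns_norm r (bifun (\<lambda>q p. of_real (q / p)) s r)"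
  proof (rule gns_norm_bifun_mono)
    fix q p :: real assume qp: "0 < q" "0 < p"
    define x where "x = q / p"
    have x: "0 < x" using qp by (simp add: x_def)
    have "\<bar>1 / (t + x) - 1 / t\<bar> = x / (t * (t + x))"
    proof -
      have "1 / (t + x) - 1 / t = - (x / (t * (t + x)))" using x assms by (simp add: field_simps)
      then show ?thesis using x assms by simp
    qed
    also have "\<dots> \<le> x / t\<^sup>2"
      using x assms by (intro divide_left_mono) (auto simp: power2_eq_square)
    finally show "cmod (of_real (1 / (t + q / p) - 1 / t)) \<le> 1 / t\<^sup>2 * cmod (of_real (q / p))"
      using x unfolding norm_of_real x_def[symmetric] by simp
  qed simp
  also have "gns_norm r (bifun (\<lambda>q p. of_real (q / p)) s r) = sqrt (Qx2 tau r s)"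
    using gns_norm_ge_0[OF r, of "s ** mpow r (- 1)"] s r
    unfolding bifun_ratio[OF s(2) r(2)] Qx2_eq_gns_norm by simp
  finally show ?thesis by (simp add: eq)
qed

lemma has_integral_rel_ent:
  "((\<lambda>t. Re (tau (resolvent s r t ** r)) - Re (tau r) / (t + 1)) has_integral rel_ent tau r s) {0..}"
proof -
  have h: "hermitian s" "hermitian r" using s r by (auto simp: posdef_def)
  let ?k = "\<lambda>t q p. complex_of_real (1 / (t + q / p) - 1 / (t + 1))"
  have "((\<lambda>t. tau (mat 1 ** bifun (?k t) s r ** r)) has_integral
      tau (mat 1 ** bifun (\<lambda>q p. of_real (- ln (q / p))) s r ** r)) {0..}"
    using s r
    by (intro bifun_has_integral has_integral_of_real has_integral_ln_resolvent) auto
  then have "((\<lambda>t. Re (tau (bifun (?k t) s r ** r))) has_integral rel_ent tau r s) {0..}"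
    unfolding rel_ent_eq_bifun matrix_mul_lid
    using has_integral_linear[OF _ bounded_linear_Re] by (auto simp: o_def)
  moreover have "Re (tau (bifun (?k t) s r ** r)) = Re (tau (resolvent s r t ** r)) - Re (tau r) / (t + 1)" for t
  proof -
    have "bifun (?k t) s r = resolvent s r t - cscale (of_real (1 / (t + 1))) (mat 1)"
      unfolding resolvent_def[OF s(2) r(2)] bifun_one[OF h, symmetric] cscale_bifun bifun_diff by simp
    then have "tau (bifun (?k t) s r ** r) = tau (resolvent s r t ** r) - of_real (1 / (t + 1)) * tau r"
      using r by (simp only: matmul_diff_left cscale_mult_left matrix_mul_lid tau_diff tau_cscale
          cscale_in mult_in resolvent_in)
    then show ?thesis by simp
  qed
  ultimately show ?thesis by simp
qed

end

end

section \<open>The entropy difference controls the rotated modular vectors\<close>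

context trace_subalgebra
begin

context
  fixes \<rho> \<sigma>
  assumes \<rho>: "\<rho> \<in> M" "posdef \<rho>" and \<sigma>: "\<sigma> \<in> M" "posdef \<sigma>"
begin

lemma E_\<rho>: "E \<rho> \<in> N" "posdef (E \<rho>)" "E \<rho> \<in> M"
  and E_\<sigma>: "E \<sigma> \<in> N" "posdef (E \<sigma>)" "E \<sigma> \<in> M"
  using E_in[OF \<rho>(1)] E_in[OF \<sigma>(1)] E_posdef[OF \<rho>] E_posdef[OF \<sigma>] by simp_all

text \<open>The GNS space of \<open>E \<rho>\<close> embeds isometrically in that of
  \<open>\<rho>\<close>, because \<open>adj b ** b\<close> lies in \<open>N\<close>.\<close>

lemma gns_norm_E: "b \<in> N \<Longrightarrow> gns_norm (E \<rho>) b = gns_norm \<rho> b"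
proof -
  assume b: "b \<in> N"
  have "(gns_norm (E \<rho>) b)\<^sup>2 = (gns_norm \<rho> b)\<^sup>2"
    using gns_norm_sq(1)[OF \<rho>, of b] gns_norm_sq(1)[OF E_\<rho>(3,2), of b] tau_E[of "adj b ** b" \<rho>] b \<rho>
    by simp
  then show ?thesis
    using gns_norm_ge_0[OF E_\<rho>(3,2) in_M[OF b]] gns_norm_ge_0[OF \<rho> in_M[OF b]]
    by (rule power2_eq_imp_eq)
qed

text \<open>\<open>b\<close> behaves as the GNS projection of \<open>a\<close> onto
  \<open>N\<close>: the trace identity makes the pairing of \<open>b\<close> with \<open>a\<close>
  equal to |b|^2, and Cauchy-Schwarz gives |b| <= |a|.\<close>

lemma Qx2_E_le: "Qx2 tau (E \<rho>) (E \<sigma>) \<le> Qx2 tau \<rho> \<sigma>"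
proof -
  define a b where "a = \<sigma> ** mpow \<rho> (- 1)" and "b = E \<sigma> ** mpow (E \<rho>) (- 1)"
  have a: "a \<in> M" using \<rho> \<sigma> by (simp add: a_def)
  have b: "b \<in> N" using E_\<rho> E_\<sigma> N.mpow_in by (simp add: b_def)
  have "a ** \<rho> = \<sigma>"
    using mpow_add[OF \<rho>(2), of "- 1" 1] \<rho> by (simp add: a_def mpow_1 mpow_0 flip: matrix_mul_assoc)
  moreover have "b ** E \<rho> = E \<sigma>"
    using mpow_add[OF E_\<rho>(2), of "- 1" 1] E_\<rho> by (simp add: b_def mpow_1 mpow_0 flip: matrix_mul_assoc)
  ultimately have "tau (adj b ** a ** \<rho>) = tau (adj b ** b ** E \<rho>)"
    using b \<sigma> by (simp add: tau_E flip: matrix_mul_assoc)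
  also have "\<dots> = of_real ((gns_norm \<rho> b)\<^sup>2)"
    using gns_norm_sq(2)[OF E_\<rho>(3,2), of b] b by (simp add: gns_norm_E)
  finally have "(gns_norm \<rho> b)\<^sup>2 \<le> gns_norm \<rho> b * gns_norm \<rho> a"
    using gns_cauchy_schwarz[OF \<rho>, of b a] a b by (simp del: of_real_power)
  then have "gns_norm \<rho> b \<le> gns_norm \<rho> a"
    using gns_norm_ge_0[OF \<rho> in_M[OF b]] gns_norm_ge_0[OF \<rho> a]
    by (cases "gns_norm \<rho> b = 0") (auto simp: power2_eq_square)
  then have "(gns_norm \<rho> b)\<^sup>2 \<le> (gns_norm \<rho> a)\<^sup>2"
    using gns_norm_ge_0[OF \<rho> in_M[OF b]] by (intro power_mono)
  then show ?thesis
    using gns_norm_E[OF b] \<rho> \<sigma> E_\<rho> E_\<sigma> by (simp add: Qx2_eq_gns_norm a_def b_def)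
qed

definition resolvent_diff :: "real \<Rightarrow> 'n cmat" where
  "resolvent_diff t = resolvent \<sigma> \<rho> t - resolvent (E \<sigma>) (E \<rho>) t"

definition resolvent_gap :: "real \<Rightarrow> real" where
  "resolvent_gap t = Re (tau (resolvent \<sigma> \<rho> t ** \<rho>)) - Re (tau (resolvent (E \<sigma>) (E \<rho>) t ** E \<rho>))"

lemma resolvent_N: "resolvent (E \<sigma>) (E \<rho>) t \<in> N"
  by (rule N.resolvent_in[OF E_\<sigma>(1,2) E_\<rho>(1,2)])

lemma resolvent_M: "resolvent \<sigma> \<rho> t \<in> M"
  by (rule resolvent_in[OF \<sigma> \<rho>])

lemma resolvent_diff_in: "resolvent_diff t \<in> M"
  using resolvent_N resolvent_M by (auto simp: resolvent_diff_def)

text \<open>The sesquilinear form \<open>B a b = tau (adj a ** (t b \<rho> + \<sigma> b))\<close> satisfies \<open>B a x = tau (adj a ** \<rho>)\<close> for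
  the resolvent vector \<open>x\<close>, and restricts on \<open>N\<close> to the corresponding form of \<open>E \<rho>\<close> and \<open>E \<sigma>\<close>.
  Hence \<open>B (x - y) (x - y)\<close> is exactly the gap.\<close>

lemma gns_norm_resolvent_diff_le_gap:
  assumes t: "0 < t"
  shows "t * (gns_norm \<rho> (resolvent_diff t))\<^sup>2 \<le> resolvent_gap t"
proof -
  define x y where "x = resolvent \<sigma> \<rho> t" and "y = resolvent (E \<sigma>) (E \<rho>) t"
  have x: "x \<in> M" using resolvent_M by (simp add: x_def)
  have yN: "y \<in> N" using resolvent_N by (simp add: y_def)
  then have y: "y \<in> M" by simp
  define B where "B a b = of_real t * tau (adj a ** b ** \<rho>) + tau (adj a ** \<sigma> ** b)" for a b
  have B_diff: "B (a - a') (b - b') = B a b - B a b' - B a' b + B a' b'"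
    if "a \<in> M" "a' \<in> M" "b \<in> M" "b' \<in> M" for a a' b b'
    using that \<rho> \<sigma> by (simp add: B_def adj_diff matmul_diff_left matmul_diff_right tau_diff) (simp add: algebra_simps)
  have Bx: "B a x = tau (adj a ** \<rho>)" if a: "a \<in> M" for a
  proof -
    have "adj a ** \<rho> = cscale (of_real t) (adj a ** x ** \<rho>) + adj a ** \<sigma> ** x"
      using arg_cong[OF resolvent_eq[OF \<sigma>(2) \<rho>(2) t], of "(**) (adj a)"]
      by (simp add: x_def matrix_add_ldistrib matrix_mul_assoc)
    then show ?thesis using a x \<rho> \<sigma> by (simp add: B_def tau_add tau_cscale)
  qed
  have Byy: "B y y = tau (adj y ** E \<rho>)"
  proof -
    have "adj y ** E \<rho> = cscale (of_real t) (adj y ** y ** E \<rho>) + adj y ** E \<sigma> ** y"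
      using arg_cong[OF resolvent_eq[OF E_\<sigma>(2) E_\<rho>(2) t], of "(**) (adj y)"]
      by (simp add: y_def matrix_add_ldistrib matrix_mul_assoc)
    then have "tau (adj y ** E \<rho>) =
        of_real t * tau (adj y ** y ** E \<rho>) + tau (adj y ** E \<sigma> ** y)"
      using y E_\<rho> E_\<sigma> by (simp add: tau_add tau_cscale)
    \<comment> \<open>Cycling puts \<open>y ** adj y\<close>, an element of \<open>N\<close>, next
      to \<open>E \<sigma>\<close>, which may then be replaced by \<open>\<sigma>\<close>.\<close>
    also have "tau (adj y ** E \<sigma> ** y) = tau (y ** adj y ** E \<sigma>)"
      using y E_\<sigma> by (intro tau_cycle) auto
    also have "\<dots> = tau (y ** adj y ** \<sigma>)" using yN \<sigma> by (simp add: tau_E)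
    also have "\<dots> = tau (adj y ** \<sigma> ** y)" using y \<sigma> by (intro tau_cycle[symmetric]) auto
    finally show ?thesis using yN \<rho> by (simp add: B_def tau_E)
  qed
  have Bsym: "B a b = cnj (B b a)" if a: "a \<in> M" "b \<in> M" for a b
  proof -
    have h: "adj \<rho> = \<rho>" "adj \<sigma> = \<sigma>" using \<rho> \<sigma> by (auto simp: posdef_def hermitian_def)
    have "tau (adj a ** b ** \<rho>) = cnj (tau (\<rho> ** adj b ** a))"
      using tau_adj[of "\<rho> ** adj b ** a"] a \<rho> by (simp add: adj_mult h matrix_mul_assoc)
    also have "tau (\<rho> ** adj b ** a) = tau (adj b ** a ** \<rho>)"
      using a \<rho> by (intro tau_cycle[symmetric]) auto
    finally have "tau (adj a ** b ** \<rho>) = cnj (tau (adj b ** a ** \<rho>))" .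
    moreover have "tau (adj a ** \<sigma> ** b) = cnj (tau (adj b ** \<sigma> ** a))"
      using tau_adj[of "adj b ** \<sigma> ** a"] a \<sigma> by (simp add: adj_mult h matrix_mul_assoc)
    ultimately show ?thesis by (simp add: B_def)
  qed
  \<comment> \<open>Galerkin orthogonality: \<open>y\<close> is the \<open>B\<close>-projection of
    \<open>x\<close> onto \<open>N\<close>, so the cross terms collapse and only
    \<open>B x x\<close> minus \<open>B y y\<close> remains.\<close>
  have Byx: "B y x = B y y" using Bx[OF y] Byy yN \<rho> by (simp add: tau_E)
  have re: "Re (tau (adj a ** c)) = Re (tau (a ** c))" if "a \<in> M" "c \<in> M" "adj c = c" for a c
    using tau_adj[of "adj a ** c"] tau_commute[of a c] that by (simp add: adj_mult)
  have "B (x - y) (x - y) = B x x - B x y - B y x + B y y"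
    by (rule B_diff) (use x y in auto)
  then have "Re (B (x - y) (x - y)) = Re (B x x) - Re (B y y)"
    using Bsym[OF x y] by (simp add: Byx)
  also have "\<dots> = resolvent_gap t"
    using re[OF x, of \<rho>] re[OF y, of "E \<rho>"] \<rho> E_\<rho>
    unfolding Bx[OF x] Byy resolvent_gap_def by (simp add: x_def y_def posdef_def hermitian_def)
  finally have gap: "Re (B (x - y) (x - y)) = resolvent_gap t" .
  let ?w = "x - y"
  have w: "?w \<in> M" using x y by simp
  \<comment> \<open>The \<open>\<sigma>\<close> part of \<open>B\<close> is nonnegative; dropping it
    leaves \<open>t\<close> times the squared norm.\<close>
  have "tau (adj ?w ** \<sigma> ** ?w) = tau (?w ** adj ?w ** \<sigma>)"
    using w \<sigma> by (intro tau_cycle) auto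
  also have "\<dots> = of_real ((gns_norm \<sigma> (adj ?w))\<^sup>2)"
    using gns_norm_sq(2)[OF \<sigma>, of "adj ?w"] w by simp
  finally have pos: "0 \<le> Re (tau (adj ?w ** \<sigma> ** ?w))" by (simp del: of_real_power)
  have "Re (B ?w ?w) = t * (gns_norm \<rho> ?w)\<^sup>2 + Re (tau (adj ?w ** \<sigma> ** ?w))"
    using gns_norm_sq(2)[OF \<rho> w, symmetric] by (simp add: B_def del: of_real_power)
  then show ?thesis using gap pos by (simp add: resolvent_diff_def x_def y_def)
qed

text \<open>The regularizing terms in 1 / (t + 1) cancel because \<open>E\<close> preserves the
  trace of \<open>\<rho>\<close>.\<close>

lemma has_integral_resolvent_gap:
  "(resolvent_gap has_integral (rel_ent tau \<rho> \<sigma> - rel_ent tau (E \<rho>) (E \<sigma>))) {0..}"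
  using has_integral_diff[OF has_integral_rel_ent[OF \<sigma> \<rho>] has_integral_rel_ent[OF E_\<sigma>(3,2) E_\<rho>(3,2)]]
    tau_E_one[OF \<rho>(1)]
  by (simp add: resolvent_gap_def[abs_def])

lemma gns_norm_resolvent_diff_le:
  assumes t: "0 < t"
  shows "gns_norm \<rho> (resolvent_diff t) \<le> 2 * sqrt (Qx2 tau \<rho> \<sigma>) / t\<^sup>2"
proof -
  let ?c = "cscale (1 / of_real t) (mat 1) :: 'n cmat"
  let ?x = "resolvent \<sigma> \<rho> t - ?c" and ?y = "resolvent (E \<sigma>) (E \<rho>) t - ?c"
  have c: "?c \<in> N" by simp
  have x: "?x \<in> M" "?y \<in> N" using resolvent_N resolvent_M c by auto
  have "gns_norm \<rho> (resolvent_diff t) = gns_norm \<rho> (?x - ?y)" by (simp add: resolvent_diff_def)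
  also have "\<dots> \<le> gns_norm \<rho> ?x + gns_norm \<rho> ?y"
    using x by (intro gns_norm_diff_le[OF \<rho>]) auto
  also have "gns_norm \<rho> ?y = gns_norm (E \<rho>) ?y" by (rule gns_norm_E[OF x(2), symmetric])
  also have "gns_norm \<rho> ?x + \<dots> \<le> sqrt (Qx2 tau \<rho> \<sigma>) / t\<^sup>2 + sqrt (Qx2 tau (E \<rho>) (E \<sigma>)) / t\<^sup>2"
    using gns_norm_resolvent_le[OF \<sigma> \<rho> t] gns_norm_resolvent_le[OF E_\<sigma>(3,2) E_\<rho>(3,2) t]
    by (intro add_mono)
  also have "\<dots> \<le> 2 * sqrt (Qx2 tau \<rho> \<sigma>) / t\<^sup>2"
    using Qx2_E_le by (simp add: field_simps divide_right_mono flip: add_divide_distrib)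
  finally show ?thesis .
qed

definition modular_diff :: "real \<Rightarrow> 'n cmat" where
  "modular_diff t = bifun (\<lambda>q p. of_real (q / p) powr (1/2 + \<i> * of_real t)) \<sigma> \<rho> -
     bifun (\<lambda>q p. of_real (q / p) powr (1/2 + \<i> * of_real t)) (E \<sigma>) (E \<rho>)"

lemma modular_diff_in: "modular_diff t \<in> M"
  unfolding modular_diff_def
  by (intro diff_in bifun_in[OF \<sigma> \<rho>] bifun_in[OF E_\<sigma>(3,2) E_\<rho>(3,2)])

text \<open>Weak form, tested against \<open>b\<close>. The terms 1 / s are the same multiple of the
  identity in both algebras, so only the resolvents survive; this is where the minus sign comes
  from.\<close>

lemma has_integral_modular_diff:
  assumes b: "b \<in> M"
  shows "((\<lambda>s. - (of_real s powr (1/2 + \<i> * of_real t)) * tau (b ** resolvent_diff s ** \<rho>))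
    has_integral of_real (pi / cosh (pi * t)) * tau (b ** modular_diff t ** \<rho>)) {0<..}"
proof -
  define z where "z = 1/2 + \<i> * complex_of_real t"
  let ?k = "\<lambda>s q p. of_real s powr z * (1 / of_real s - 1 / complex_of_real (s + q / p))"
  let ?I = "\<lambda>q p. of_real (pi / cosh (pi * t)) * complex_of_real (q / p) powr z"
  have I: "((\<lambda>s. ?k s q p) has_integral ?I q p) {0<..}" if "0 < q" "0 < p" for q p
    using has_integral_powr_resolvent[of "q / p" t] that by (simp add: z_def)
  have i1: "((\<lambda>s. tau (b ** bifun (?k s) \<sigma> \<rho> ** \<rho>)) has_integral tau (b ** bifun ?I \<sigma> \<rho> ** \<rho>)) {0<..}"
    by (rule bifun_has_integral[OF \<sigma> \<rho> b \<rho>(1) I])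
  \<comment> \<open>The pair in \<open>N\<close> is also weighted with \<open>\<rho>\<close>: both
    vectors are paired with \<open>b\<close> in the larger GNS space.\<close>
  have i2: "((\<lambda>s. tau (b ** bifun (?k s) (E \<sigma>) (E \<rho>) ** \<rho>)) has_integral
      tau (b ** bifun ?I (E \<sigma>) (E \<rho>) ** \<rho>)) {0<..}"
    by (rule bifun_has_integral[OF E_\<sigma>(3,2) E_\<rho>(3,2) b \<rho>(1) I])
  have lin: "tau (b ** cscale c A ** \<rho>) - tau (b ** cscale c A' ** \<rho>) = c * tau (b ** (A - A') ** \<rho>)"
    if "A \<in> M" "A' \<in> M" for c A A'
    using that b \<rho> by (simp add: tau_cscale tau_diff matmul_diff_left matmul_diff_right right_diff_distrib)
  note bM = bifun_in[OF \<sigma> \<rho>] bifun_in[OF E_\<sigma>(3,2) E_\<rho>(3,2)]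
  have "tau (b ** bifun ?I \<sigma> \<rho> ** \<rho>) - tau (b ** bifun ?I (E \<sigma>) (E \<rho>) ** \<rho>) =
      of_real (pi / cosh (pi * t)) * tau (b ** modular_diff t ** \<rho>)"
    unfolding cscale_bifun[symmetric] lin[OF bM] modular_diff_def z_def ..
  moreover have "tau (b ** bifun (?k s) \<sigma> \<rho> ** \<rho>) - tau (b ** bifun (?k s) (E \<sigma>) (E \<rho>) ** \<rho>) =
      - (of_real s powr z) * tau (b ** resolvent_diff s ** \<rho>)" for s
  proof -
    have "bifun (\<lambda>q p. 1 / of_real s - 1 / complex_of_real (s + q / p)) \<sigma> \<rho> -
        bifun (\<lambda>q p. 1 / of_real s - 1 / complex_of_real (s + q / p)) (E \<sigma>) (E \<rho>) = cscale (- 1) (resolvent_diff s)"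
    proof -
      have 1: "bifun (\<lambda>q p. c) a r = cscale c (mat 1)" if "posdef a" "posdef r" for a r and c
        using cscale_bifun[of c "\<lambda>q p. 1" a r] that by (simp add: bifun_one posdef_hermitian)
      show ?thesis
        unfolding bifun_diff[symmetric]
        using \<sigma> \<rho> E_\<sigma> E_\<rho>
        by (simp add: 1 cscale_minus_left resolvent_diff_def resolvent_def)
    qed
    then show ?thesis
      unfolding cscale_bifun[symmetric] lin[OF bM]
      using b \<rho> resolvent_diff_in by (simp add: tau_cscale)
  qed
  ultimately show ?thesis
    using has_integral_diff[OF i1 i2] by (simp add: z_def)
qed

text \<open>The data processing inequality, as the integral of a nonnegative gap.\<close>

lemma entropy_difference_nonneg: "0 \<le> rel_ent tau \<rho> \<sigma> - rel_ent tau (E \<rho>) (E \<sigma>)"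
proof -
  have "(resolvent_gap has_integral (rel_ent tau \<rho> \<sigma> - rel_ent tau (E \<rho>) (E \<sigma>))) {0<..}"
    unfolding has_integral_Ioi_iff by (rule has_integral_resolvent_gap)
  then show ?thesis
  proof (rule has_integral_nonneg)
    fix t :: real assume t: "t \<in> {0<..}"
    have "0 \<le> t * (gns_norm \<rho> (resolvent_diff t))\<^sup>2" using t by simp
    also have "\<dots> \<le> resolvent_gap t" using t gns_norm_resolvent_diff_le_gap[of t] by simp
    finally show "0 \<le> resolvent_gap t" .
  qed
qed

text \<open>Testing the weak formula against the vector itself gives its squared norm, and one
  factor is divided out. \<open>T\<close> separates the two regimes; \<open>e\<close> is the weight
  in a <= e a^2 / 2 + 1 / (2 e), which stands in for Cauchy-Schwarz so that pointwise domination of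
  the integrand is enough.\<close>

lemma gns_norm_modular_diff_le:
  assumes e: "0 < e" and T: "0 < T"
  shows "pi / cosh (pi * t) * gns_norm \<rho> (modular_diff t) \<le>
    e / 2 * (rel_ent tau \<rho> \<sigma> - rel_ent tau (E \<rho>) (E \<sigma>)) + T / (2 * e) +
      4 * sqrt (Qx2 tau \<rho> \<sigma>) / sqrt T"
proof -
  define z where "z = 1/2 + \<i> * complex_of_real t"
  define W where "W = modular_diff t"
  define Q where "Q = sqrt (Qx2 tau \<rho> \<sigma>)"
  define d where "d = rel_ent tau \<rho> \<sigma> - rel_ent tau (E \<rho>) (E \<sigma>)"
  have W: "W \<in> M" by (simp add: W_def modular_diff_in)
  define nW where "nW = gns_norm \<rho> W"
  have nW0: "0 \<le> nW" unfolding nW_def by (rule gns_norm_ge_0[OF \<rho> W])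
  let ?f = "\<lambda>s. - (of_real s powr z) * tau (adj W ** resolvent_diff s ** \<rho>)"
  have f: "(?f has_integral of_real (pi / cosh (pi * t) * nW\<^sup>2)) {0<..}"
    using has_integral_modular_diff[of "adj W" t] W gns_norm_sq(2)[OF \<rho> W]
    by (simp add: z_def nW_def W_def[symmetric] del: of_real_power)
  \<comment> \<open>The part of the majorant free of the gap: the Young constant up to
    \<open>T\<close>, then the a priori bound times sqrt(s). Both branches are active at
    \<open>s = T\<close>, which changes neither the integral nor the domination.\<close>
  define g where "g s = (if s \<le> T then 1 / (2 * e) else 0) + (if T \<le> s then 2 * Q * s powr (-3/2) else 0)" for s
  have g: "(g has_integral (T / (2 * e) + 4 * Q / sqrt T)) {0<..}"
  proof -
    have "((\<lambda>s. 1 / (2 * e)) has_integral T / (2 * e)) {0..T}"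
      using has_integral_const_real[of "1 / (2 * e)" 0 T] T by simp
    then have "((\<lambda>s. if s \<in> {0..T} then 1 / (2 * e) else 0) has_integral T / (2 * e)) {0..}"
      by (subst has_integral_restrict) auto
    then have 1: "((\<lambda>s. if s \<le> T then 1 / (2 * e) else 0) has_integral T / (2 * e)) {0..}"
      by (rule has_integral_eq[rotated]) auto
    have "((\<lambda>s. 2 * Q * s powr (-3/2)) has_integral 2 * Q * (- (T powr (-3/2 + 1)) / (-3/2 + 1))) {T..}"
      using T by (intro has_integral_mult_right has_integral_powr_to_inf) auto
    moreover have "T powr (-3/2 + 1) = 1 / sqrt T"
    proof -
      have "T powr (-3/2 + 1) = T powr (- (1/2))" by simp
      also have "\<dots> = inverse (T powr (1/2))" by (rule powr_minus)
      finally show ?thesis using T by (simp add: powr_half_sqrt inverse_eq_divide)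
    qed
    ultimately have "((\<lambda>s. 2 * Q * s powr (-3/2)) has_integral 4 * Q / sqrt T) {T..}"
      by simp
    then have "((\<lambda>s. if s \<in> {T..} then 2 * Q * s powr (-3/2) else 0) has_integral 4 * Q / sqrt T) {0..}"
      using T by (subst has_integral_restrict) auto
    then have 2: "((\<lambda>s. if T \<le> s then 2 * Q * s powr (-3/2) else 0) has_integral 4 * Q / sqrt T) {0..}"
      by simp
    have "(g has_integral (T / (2 * e) + 4 * Q / sqrt T)) {0..}"
      unfolding g_def[abs_def] by (rule has_integral_add[OF 1 2])
    then show ?thesis unfolding has_integral_Ioi_iff .
  qed
  have G: "(resolvent_gap has_integral d) {0<..}"
    unfolding d_def has_integral_Ioi_iff by (rule has_integral_resolvent_gap)
  have bound: "norm (?f s) \<le> nW * (e / 2 * resolvent_gap s + g s)" if "s \<in> {0<..}" for s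
  proof -
    have s: "0 < s" using that by simp
    define w where "w = gns_norm \<rho> (resolvent_diff s)"
    have w0: "0 \<le> w" unfolding w_def by (rule gns_norm_ge_0[OF \<rho> resolvent_diff_in])
    have gap: "s * w\<^sup>2 \<le> resolvent_gap s"
      unfolding w_def by (rule gns_norm_resolvent_diff_le_gap[OF s])
    moreover have "0 \<le> s * w\<^sup>2" using s by simp
    ultimately have gap0: "0 \<le> resolvent_gap s" by linarith
    have "norm (?f s) = sqrt s * cmod (tau (adj W ** resolvent_diff s ** \<rho>))"
      using s by (simp add: norm_mult norm_powr_real_powr z_def powr_half_sqrt)
    also have "\<dots> \<le> sqrt s * (nW * w)"
      unfolding nW_def w_def using s
      by (intro mult_left_mono gns_cauchy_schwarz[OF \<rho>] W resolvent_diff_in) auto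
    also have "\<dots> = nW * (sqrt s * w)" by simp
    also have "\<dots> \<le> nW * (e / 2 * resolvent_gap s + g s)"
    proof (rule mult_left_mono[OF _ nW0])
      show "sqrt s * w \<le> e / 2 * resolvent_gap s + g s"
      proof (cases "s \<le> T")
        case True
        define a where "a = sqrt s * w"
        have "a\<^sup>2 = s * w\<^sup>2" using s by (simp add: a_def power_mult_distrib)
        then have "a\<^sup>2 \<le> resolvent_gap s" using gap by simp
        then have "e / 2 * a\<^sup>2 \<le> e / 2 * resolvent_gap s"
          using e by (intro mult_left_mono) auto
        moreover have "a \<le> e / 2 * a\<^sup>2 + 1 / (2 * e)"
        proof -
          have "0 \<le> (e * a - 1)\<^sup>2 / (2 * e)" using e by simp
          also have "\<dots> = e / 2 * a\<^sup>2 + 1 / (2 * e) - a"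
            using e by (simp add: power2_eq_square field_simps)
          finally show ?thesis by simp
        qed
        moreover have "1 / (2 * e) \<le> g s"
        proof -
          have "0 \<le> Q" unfolding Q_def using Qx2_eq_gns_norm[OF \<sigma> \<rho>] by simp
          then show ?thesis using True by (simp add: g_def)
        qed
        ultimately show ?thesis by (simp add: a_def)
      next
        case False
        have "sqrt s * w \<le> sqrt s * (2 * Q / s\<^sup>2)"
          unfolding w_def Q_def using s
          by (intro mult_left_mono gns_norm_resolvent_diff_le) auto
        also have "\<dots> = 2 * Q * s powr (-3/2)"
        proof -
          have "s powr (-3/2) = s powr (1/2 - 2)" by simp
          also have "\<dots> = s powr (1/2) / s powr 2" by (rule powr_diff)
          also have "\<dots> = sqrt s / s\<^sup>2" using s by (simp add: powr_half_sqrt)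
          finally show ?thesis by simp
        qed
        also have "\<dots> = g s" using False by (simp add: g_def)
        finally show ?thesis using gap0 e by (simp add: add_increasing)
      qed
    qed
    finally show ?thesis .
  qed
  have rhs: "((\<lambda>s. nW * (e / 2 * resolvent_gap s + g s)) has_integral
      nW * (e / 2 * d + (T / (2 * e) + 4 * Q / sqrt T))) {0<..}"
    by (rule has_integral_mult_right[OF has_integral_add[OF has_integral_mult_right[OF G] g]])
  have "norm (integral {0<..} ?f) \<le> integral {0<..} (\<lambda>s. nW * (e / 2 * resolvent_gap s + g s))"
    by (rule Henstock_Kurzweil_Integration.integral_norm_bound_integral
        [OF has_integral_integrable[OF f] has_integral_integrable[OF rhs] bound])
  then have "norm (complex_of_real (pi / cosh (pi * t) * nW\<^sup>2)) \<le>
      nW * (e / 2 * d + (T / (2 * e) + 4 * Q / sqrt T))"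
    by (simp only: integral_unique[OF f] integral_unique[OF rhs])
  then have *: "nW * (pi / cosh (pi * t) * nW) \<le> nW * (e / 2 * d + (T / (2 * e) + 4 * Q / sqrt T))"
    unfolding norm_of_real by (simp add: power2_eq_square mult_ac)
  have d0: "0 \<le> d" unfolding d_def by (rule entropy_difference_nonneg)
  have Q0: "0 \<le> Q" unfolding Q_def using Qx2_eq_gns_norm[OF \<sigma> \<rho>] by simp
  \<comment> \<open>Cancelling \<open>nW\<close> requires it to be nonzero; for
    \<open>nW = 0\<close> the right side is nonnegative anyway.\<close>
  have "pi / cosh (pi * t) * nW \<le> e / 2 * d + (T / (2 * e) + 4 * Q / sqrt T)"
  proof (cases "nW = 0")
    case True
    then show ?thesis using d0 Q0 e T by simp
  next
    case False
    then show ?thesis using * nW0 by (intro mult_left_le_imp_le[OF *]) simp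
  qed
  then show ?thesis by (simp add: nW_def W_def d_def Q_def add.assoc)
qed

lemma gns_norm_modular_diff_pow4_le:
  assumes Q: "0 < Qx2 tau \<rho> \<sigma>"
  shows "(pi / (4 * cosh (pi * t)) * gns_norm \<rho> (modular_diff t)) ^ 4 \<le>
    Qx2 tau \<rho> \<sigma> * (rel_ent tau \<rho> \<sigma> - rel_ent tau (E \<rho>) (E \<sigma>))" (is "?n ^ 4 \<le> ?Q * ?D")
proof -
  have n0: "0 \<le> ?n" using gns_norm_ge_0[OF \<rho> modular_diff_in] by simp
  \<comment> \<open>The optimal parameters divide by the entropy difference, which may vanish.
    Working with every strictly larger \<open>d\<close> and letting it decrease covers that
    case.\<close>
  have "?n ^ 4 / ?Q \<le> d" if d: "?D < d" for d
  proof -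
    have d0: "0 < d" using d entropy_difference_nonneg by linarith
    define k where "k = root 4 (?Q * d)"
    have k: "0 < k" "k ^ 4 = ?Q * d" using Q d0 by (auto simp: k_def)
    \<comment> \<open>The minimizers of the bound with \<open>d\<close> for the entropy difference.
      The three terms become \<open>k\<close>, \<open>k\<close> and \<open>2 * k\<close>, whose sum
      is the source of the 4.\<close>
    define e T where "e = 2 * k / d" and "T = (2 * k)\<^sup>2 / d"
    have eT: "0 < e" "0 < T" using k d0 by (auto simp: e_def T_def)
    have sT: "sqrt T = 2 * k / sqrt d" unfolding T_def real_sqrt_divide real_sqrt_abs using k by simp
    have sQ: "sqrt ?Q = k\<^sup>2 / sqrt d"
    proof (rule real_sqrt_unique)
      have "(k\<^sup>2)\<^sup>2 = k ^ 4" by (simp flip: power_mult)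
      then show "(k\<^sup>2 / sqrt d)\<^sup>2 = ?Q" using k d0 by (simp add: power_divide)
    qed (use k d0 in simp)
    have "pi / cosh (pi * t) * gns_norm \<rho> (modular_diff t) \<le>
        e / 2 * ?D + T / (2 * e) + 4 * sqrt ?Q / sqrt T"
      by (rule gns_norm_modular_diff_le[OF eT])
    also have "\<dots> \<le> e / 2 * d + T / (2 * e) + 4 * sqrt ?Q / sqrt T"
      using d eT by simp
    also have "e / 2 * d = k" using d0 by (simp add: e_def)
    also have "T / (2 * e) = k" using d0 k by (simp add: e_def T_def power2_eq_square)
    also have "4 * sqrt ?Q / sqrt T = 2 * k"
      unfolding sT sQ using d0 k by (simp add: power2_eq_square)
    finally have "?n \<le> k" by (simp add: field_simps)
    then have "?n ^ 4 \<le> k ^ 4" using n0 by (rule power_mono)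
    then show ?thesis using k Q by (simp add: divide_le_eq mult.commute)
  qed
  then have "?n ^ 4 / ?Q \<le> ?D" by (rule dense_ge)
  then show ?thesis using Q by (simp add: divide_le_eq mult.commute)
qed

end

end

section \<open>Trace norm bounds for the rotated Petz maps\<close>

lemma invertible_unitary_left:
  fixes S :: "'n::finite cmat" shows "adj S ** S = mat 1 \<Longrightarrow> S ** adj S = mat 1"
  using matrix_left_right_inverse by blast

context trace_algebra
begin

text \<open>The sign of \<open>x\<close> realizes the trace norm as a linear functional of
  \<open>x\<close>, so a bound on tau(S x) uniform over unitary S in \<open>M\<close> controls
  \<open>norm1\<close>.\<close>

lemma norm1_eq_tau_sign:
  assumes x: "x \<in> M" "hermitian x"
  obtains S where "S \<in> M" "adj S ** S = mat 1" "norm1 tau x = Re (tau (S ** x))"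
proof -
  \<comment> \<open>The value at 0 is 1 rather than 0, which keeps \<open>S\<close> unitary when
    \<open>x\<close> is singular.\<close>
  define f :: "real \<Rightarrow> complex" where "f l = (if l < 0 then - 1 else 1)" for l
  define S where "S = matfun f x"
  have "S \<in> M" unfolding S_def by (rule matfun_in_star_subalg[OF x(2) star_subalg x(1)])
  moreover have "adj S ** S = mat 1"
  proof -
    have "(\<lambda>l. cnj (f l) * f l) = (\<lambda>l. 1)" by (auto simp: f_def)
    then show ?thesis unfolding S_def by (simp add: adj_matfun matfun_mult x matfun_const)
  qed
  moreover have "mabs x = S ** x"
  proof -
    have "(\<lambda>l. f l * of_real l) = (\<lambda>l. complex_of_real \<bar>l\<bar>)" by (auto simp: f_def)
    then show ?thesis
      using matfun_mult[OF x(2), of f of_real] by (simp add: S_def mabs_hermitian x matfun_id)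
  qed
  ultimately show ?thesis using that by (simp add: norm1_def)
qed

lemma hs_norm_mult_unitary:
  assumes "a \<in> M" "S \<in> M" "S ** adj S = mat 1"
  shows "hs_norm (a ** S) = hs_norm a"
proof -
  have "tau (adj (a ** S) ** (a ** S)) = tau (adj S ** (adj a ** a) ** S)"
    by (simp add: adj_mult matrix_mul_assoc)
  also have "\<dots> = tau ((adj a ** a) ** S ** adj S)"
    using assms by (intro tau_cycle[symmetric]) auto
  also have "\<dots> = tau (adj a ** a)"
    using assms(3) by (simp flip: matrix_mul_assoc)
  finally show ?thesis by (simp add: hs_norm_def)
qed

text \<open>With D = X - Y, the difference of squares is (adj X) D + (adj D) Y. Each summand costs
  one Cauchy-Schwarz with a factor of norm 1, and unitaries preserve the norm; hence the 2.\<close>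

lemma tau_unitary_square_diff_le:
  assumes X: "X \<in> M" and Y: "Y \<in> M" and S: "S \<in> M" "adj S ** S = mat 1"
    and norms: "hs_norm X = 1" "hs_norm Y = 1"
  shows "cmod (tau (S ** (adj X ** X - adj Y ** Y))) \<le> 2 * hs_norm (X - Y)"
proof -
  note S' = invertible_unitary_left[OF S(2)]
  have "S ** (adj X ** X - adj Y ** Y) = S ** adj X ** (X - Y) + S ** adj (X - Y) ** Y"
    by (simp add: adj_diff matmul_diff_left matmul_diff_right matrix_mul_assoc)
  then have "tau (S ** (adj X ** X - adj Y ** Y)) =
      tau (S ** adj X ** (X - Y)) + tau (S ** adj (X - Y) ** Y)"
    using X Y S by (simp add: tau_add)
  also have "tau (S ** adj X ** (X - Y)) = tau (adj (X ** adj S) ** (X - Y))"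
    by (simp add: adj_mult)
  also have "tau (S ** adj (X - Y) ** Y) = tau (adj (X - Y) ** Y ** S)"
    using X Y S by (intro tau_cycle[symmetric]) auto
  also have "adj (X - Y) ** Y ** S = adj (X - Y) ** (Y ** S)" by (simp add: matrix_mul_assoc)
  finally have "cmod (tau (S ** (adj X ** X - adj Y ** Y))) \<le>
      cmod (tau (adj (X ** adj S) ** (X - Y))) + cmod (tau (adj (X - Y) ** (Y ** S)))"
    by (simp add: norm_triangle_ineq)
  also have "\<dots> \<le> hs_norm (X ** adj S) * hs_norm (X - Y) + hs_norm (X - Y) * hs_norm (Y ** S)"
    using X Y S by (intro add_mono hs_cauchy_schwarz) auto
  also have "\<dots> = 2 * hs_norm (X - Y)"
    using X Y S S' norms by (simp add: hs_norm_mult_unitary)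
  finally show ?thesis .
qed

end

section \<open>Integrability of bounded continuous matrix functions\<close>

lemma cscale_eq_bounded_linear: "bounded_linear (\<lambda>c. cscale c A)"
  for A :: "'n::finite cmat"
  by (intro linear_conv_bounded_linear[THEN iffD1] linearI)
    (auto intro!: cmat_eqI simp: algebra_simps)

lemma bounded_bilinear_matmul: "bounded_bilinear ((**) :: 'n::finite cmat \<Rightarrow> 'n cmat \<Rightarrow> 'n cmat)"
  by (intro bilinear_conv_bounded_bilinear[THEN iffD1])
    (auto simp: bilinear_def matmul_add_left matrix_add_ldistrib matmul_scaleR intro!: linearI)

lemma bounded_linear_adj: "bounded_linear (adj :: 'n::finite cmat \<Rightarrow> 'n cmat)"
  by (intro linear_conv_bounded_linear[THEN iffD1] linearI) (simp_all add: adj_add adj_scaleR)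

text \<open>A class closed under products and finite sums whose members are Bochner integrable
  against an integrable weight, so that the rotated maps can be treated factor by factor.\<close>

definition bounded_continuous :: "(real \<Rightarrow> 'a::real_normed_vector) \<Rightarrow> bool" where
  "bounded_continuous f \<longleftrightarrow> continuous_on UNIV f \<and> bounded (range f)"

lemma bounded_continuous_matmul:
  fixes f g :: "real \<Rightarrow> 'n::finite cmat"
  assumes "bounded_continuous f" "bounded_continuous g"
  shows "bounded_continuous (\<lambda>t. f t ** g t)"
proof -
  interpret bounded_bilinear "(**) :: 'n cmat \<Rightarrow> 'n cmat \<Rightarrow> 'n cmat"
    by (rule bounded_bilinear_matmul)
  obtain K where K: "\<And>(a::'n cmat) (b::'n cmat). norm (a ** b) \<le> norm a * norm b * K" "0 < K"
    using pos_bounded by blast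
  obtain A B where A: "\<And>t. norm (f t) \<le> A" and B: "\<And>t. norm (g t) \<le> B"
    using assms by (auto simp: bounded_continuous_def bounded_iff)
  have "norm (f t ** g t) \<le> A * B * K" for t
  proof -
    have "norm (f t ** g t) \<le> norm (f t) * norm (g t) * K" by (rule K)
    also have "\<dots> \<le> A * B * K"
      using A[of t] B[of t] K(2) by (intro mult_right_mono mult_mono) (auto intro: order_trans[OF norm_ge_zero])
    finally show ?thesis .
  qed
  then show ?thesis
    using assms continuous_on by (auto simp: bounded_continuous_def bounded_iff)
qed

lemma bounded_continuous_const: "bounded_continuous (\<lambda>t. c)"
  by (simp add: bounded_continuous_def)

lemma bounded_continuous_sum:
  "(\<And>k. k \<in> S \<Longrightarrow> bounded_continuous (f k)) \<Longrightarrow> bounded_continuous (\<lambda>t. \<Sum>k\<in>S. f k t)"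
proof (induction S rule: infinite_finite_induct)
  case (insert k S)
  have "bounded_continuous (\<lambda>t. f k t + (\<Sum>k\<in>S. f k t))"
    using insert unfolding bounded_continuous_def
    by (auto intro!: continuous_on_add bounded_plus_comp)
  then show ?case using insert.hyps by simp
qed (simp_all add: bounded_continuous_const)

text \<open>With the real part of the exponent frozen, each coefficient l^z has constant modulus
  l^a; only phases vary with \<open>t\<close>.\<close>

lemma bounded_continuous_mpow:
  assumes A: "posdef A" and z: "continuous_on UNIV z" "\<And>t. Re (z t) = a"
  shows "bounded_continuous (\<lambda>t. mpow A (z t))"
proof -
  have "bounded_continuous (\<lambda>t. cscale (complex_of_real l powr z t) (eigproj A l))" if "l \<in> spec A" for l
  proof -
    have l: "0 < l" using A that by (simp add: posdef_def)
    interpret bounded_linear "\<lambda>c. cscale c (eigproj A l)" by (rule cscale_eq_bounded_linear)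
    obtain K where K: "\<And>c. norm (cscale c (eigproj A l)) \<le> norm c * K" using bounded by blast
    have "norm (cscale (complex_of_real l powr z t) (eigproj A l)) \<le> l powr a * K" for t
      using K[of "complex_of_real l powr z t"] l by (simp add: norm_powr_real_powr z)
    then have "bounded (range (\<lambda>t. cscale (complex_of_real l powr z t) (eigproj A l)))"
      by (auto simp: bounded_iff)
    moreover have "continuous_on UNIV (\<lambda>t. cscale (complex_of_real l powr z t) (eigproj A l))"
    proof (rule continuous_on)
      show "continuous_on UNIV (\<lambda>t. complex_of_real l powr z t)"
        using l z(1) by (simp add: powr_def) (intro continuous_intros)
    qed
    ultimately show ?thesis by (simp add: bounded_continuous_def)
  qed
  then show ?thesis
    unfolding mpow_def matfun_expand[OF posdef_hermitian[OF A]]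
    by (rule bounded_continuous_sum)
qed

lemma integrable_scaleR_bounded_continuous:
  fixes f :: "real \<Rightarrow> 'a::euclidean_space"
  assumes w: "integrable lborel w" "\<And>t. 0 \<le> w t" and f: "bounded_continuous f"
  shows "integrable lborel (\<lambda>t. w t *\<^sub>R f t)"
proof -
  obtain C where C: "\<And>t. norm (f t) \<le> C" using f by (auto simp: bounded_continuous_def bounded_iff)
  have "f \<in> borel_measurable borel"
    using f by (intro borel_measurable_continuous_onI) (simp add: bounded_continuous_def)
  then have "(\<lambda>t. w t *\<^sub>R f t) \<in> borel_measurable lborel"
    using w(1) by (intro borel_measurable_scaleR) auto
  moreover have "norm (w t *\<^sub>R f t) \<le> norm (w t * C)" for t
  proof -
    have "norm (w t *\<^sub>R f t) \<le> w t * C" using w(2) C by (simp add: mult_left_mono)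
    then show ?thesis by simp
  qed
  moreover have "integrable lborel (\<lambda>t. w t * C)" using w(1) by simp
  ultimately show ?thesis
    using Bochner_Integration.integrable_bound[of lborel "\<lambda>t. w t * C"] by blast
qed

section \<open>The averaging density beta\<close>

lemma has_bochner_integral_FTC_UNIV:
  fixes f F :: "real \<Rightarrow> real"
  assumes "\<And>x. DERIV F x :> f x" "\<And>x. isCont f x" "\<And>x. 0 \<le> f x"
    and "(F \<longlongrightarrow> A) at_bot" "(F \<longlongrightarrow> B) at_top"
  shows "has_bochner_integral lborel f (B - A)"
proof -
  have "set_integrable lborel (einterval (- \<infinity>) \<infinity>) f" "(LBINT x=-\<infinity>..\<infinity>. f x) = B - A"
    by (rule interval_integral_FTC_nonneg; use assms in \<open>simp add: ereal_tendsto_simps\<close>)+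
  then show ?thesis
    by (simp add: has_bochner_integral_iff set_integrable_def interval_lebesgue_integral_def
        set_lebesgue_integral_def)
qed

text \<open>\<open>beta_dens\<close> is the logistic density of rate pi, which gives the primitive
  \<open>?F\<close>.\<close>

lemma has_bochner_integral_beta_dens: "has_bochner_integral lborel beta_dens 1"
proof -
  let ?F = "\<lambda>t. - 1 / (1 + exp (pi * t))"
  have pos: "0 < cosh x + 1" "cosh x + 1 \<noteq> 0" for x :: real using cosh_real_pos[of x] by linarith+
  have "has_bochner_integral lborel beta_dens (0 - (- 1))"
  proof (rule has_bochner_integral_FTC_UNIV)
    show "DERIV ?F t :> beta_dens t" for t
    proof -
      have e: "1 + exp (pi * t) \<noteq> 0" "1 + exp (pi * t) > 0" by (smt (verit) exp_gt_zero)+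
      have "DERIV ?F t :> pi * exp (pi * t) / (1 + exp (pi * t))\<^sup>2"
        using e by (auto intro!: derivative_eq_intros simp: power2_eq_square)
      also have "pi * exp (pi * t) / (1 + exp (pi * t))\<^sup>2 = beta_dens t"
        using e by (simp add: beta_dens_def cosh_field_def exp_minus field_simps power2_eq_square)
      finally show ?thesis .
    qed
    show "isCont beta_dens t" for t
      unfolding beta_dens_def by (intro continuous_intros) (rule pos)
    show "0 \<le> beta_dens t" for t
      using pos[of "pi * t"] by (simp add: beta_dens_def)
    show "(?F \<longlongrightarrow> - 1) at_bot" by real_asymp
    show "(?F \<longlongrightarrow> 0) at_top" by real_asymp
  qed
  then show ?thesis by simp
qed

lemma beta_dens_nonneg: "0 \<le> beta_dens t"
  by (simp add: beta_dens_def add_nonneg_nonneg)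

text \<open>Since cosh(pi t) + 1 = 2 cosh(pi t / 2)^2, the integrand is pi / (4 cosh(pi t / 2)), the
  derivative of the arctangent of exp(pi t / 2). It averages the growth in t of the rotated
  bound.\<close>

lemma has_bochner_integral_beta_dens_cosh:
  "has_bochner_integral lborel (\<lambda>t. beta_dens t * cosh (pi * (t / 2))) (pi / 2)"
proof -
  let ?F = "\<lambda>t. arctan (exp (pi * (t / 2)))"
  have pos: "0 < cosh x + 1" "cosh x + 1 \<noteq> 0" for x :: real using cosh_real_pos[of x] by linarith+
  have "has_bochner_integral lborel (\<lambda>t. beta_dens t * cosh (pi * (t / 2))) (pi / 2 - 0)"
  proof (rule has_bochner_integral_FTC_UNIV)
    show "DERIV ?F t :> beta_dens t * cosh (pi * (t / 2))" for t
    proof -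
      define u where "u = exp (pi * (t / 2))"
      have u: "0 < u" by (simp add: u_def)
      have uu: "exp (pi * t) = u\<^sup>2" by (simp add: u_def power2_eq_square flip: exp_add)
      have "DERIV ?F t :> pi / 2 * u / (1 + u\<^sup>2)"
        unfolding u_def by (auto intro!: derivative_eq_intros simp: field_simps)
      also have "pi / 2 * u / (1 + u\<^sup>2) = beta_dens t * cosh (pi * (t / 2))"
      proof -
        have c1: "cosh (pi * t) + 1 = (1 + u\<^sup>2)\<^sup>2 / (2 * u\<^sup>2)"
          unfolding cosh_field_def exp_minus uu using u by (simp add: field_simps power2_eq_square)
        have c2: "cosh (pi * (t / 2)) = (1 + u\<^sup>2) / (2 * u)"
          unfolding cosh_field_def exp_minus u_def[symmetric] using u
          by (simp add: field_simps power2_eq_square)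
        define D where "D = 1 + u\<^sup>2"
        have "D \<noteq> 0" unfolding D_def by (smt (verit) zero_le_power2)
        then show ?thesis
          unfolding beta_dens_def c1 c2 D_def[symmetric] using u by (simp add: field_simps power2_eq_square)
      qed
      finally show ?thesis .
    qed
    show "isCont (\<lambda>t. beta_dens t * cosh (pi * (t / 2))) t" for t
      unfolding beta_dens_def by (intro continuous_intros) (use pos in auto)
    show "0 \<le> beta_dens t * cosh (pi * (t / 2))" for t
      by (simp add: beta_dens_nonneg)
    show "(?F \<longlongrightarrow> 0) at_bot" by real_asymp
    show "(?F \<longlongrightarrow> pi / 2) at_top" by real_asymp
  qed
  then show ?thesis by simp
qed

section \<open>Exchanging the trace with Bochner integrals\<close>

context trace_algebra
begin

text \<open>A linear retraction onto \<open>M\<close> extends the functional x -> tau(S x), linear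
  only on \<open>M\<close>, to a bounded linear map on all matrices, as the exchange with an
  integral demands.\<close>

lemma projection_onto:
  obtains P where "bounded_linear P" "\<And>x. P x \<in> M" "\<And>x. x \<in> M \<Longrightarrow> P x = x"
proof -
  have "subspace M"
    unfolding subspace_def cscale_of_real[symmetric] by simp
  from linear_exists_left_inverse_on[OF linear_id this inj_on_id]
  obtain P where "P ` UNIV \<subseteq> M" "linear P" "\<forall>x\<in>M. P (id x) = x"
    by blast
  then show ?thesis
    by (intro that[of P]) (simp_all add: image_subset_iff linear_conv_bounded_linear[symmetric])
qed

lemma integral_in:
  fixes f :: "real \<Rightarrow> 'n cmat"
  assumes "integrable lborel f" "\<And>t. f t \<in> M"
  shows "integral\<^sup>L lborel f \<in> M"
proof -
  obtain P where P: "bounded_linear P" "\<And>x. P x \<in> M" "\<And>x. x \<in> M \<Longrightarrow> P x = x"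
    using projection_onto by blast
  have "P (integral\<^sup>L lborel f) = (\<integral>t. P (f t) \<partial>lborel)"
    by (rule integral_bounded_linear[OF P(1) assms(1), symmetric])
  also have "\<dots> = integral\<^sup>L lborel f" using P assms by simp
  finally show ?thesis using P(2) by metis
qed

lemma tau_integral:
  fixes f :: "real \<Rightarrow> 'n cmat"
  assumes f: "integrable lborel f" "\<And>t. f t \<in> M" and S: "S \<in> M"
  shows "integrable lborel (\<lambda>t. tau (S ** f t))"
    "tau (S ** integral\<^sup>L lborel f) = (\<integral>t. tau (S ** f t) \<partial>lborel)"
proof -
  obtain P where P: "bounded_linear P" "\<And>x. P x \<in> M" "\<And>x. x \<in> M \<Longrightarrow> P x = x"
    using projection_onto by blast
  define g where "g x = tau (S ** P x)" for x
  have "linear g"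
  proof (rule linearI)
    fix x y and r :: real
    show "g (x + y) = g x + g y"
      using P S by (simp add: g_def bounded_linear.linear linear_add matrix_add_ldistrib tau_add)
    have "P (r *\<^sub>R x) = cscale (of_real r) (P x)"
      using P(1) by (simp add: bounded_linear.linear linear_scale cscale_of_real)
    then show "g (r *\<^sub>R x) = r *\<^sub>R g x"
      using P S by (simp add: g_def tau_cscale scaleR_conv_of_real)
  qed
  then have g: "bounded_linear g" by (simp add: linear_conv_bounded_linear)
  have gM: "g x = tau (S ** x)" if "x \<in> M" for x using P that by (simp add: g_def)
  show "integrable lborel (\<lambda>t. tau (S ** f t))"
    using integrable_bounded_linear[OF g f(1)] by (simp add: gM f)
  show "tau (S ** integral\<^sup>L lborel f) = (\<integral>t. tau (S ** f t) \<partial>lborel)"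
    using integral_bounded_linear[OF g f(1)] by (simp add: gM f integral_in)
qed

end

section \<open>The rotated and universal Petz maps\<close>

context trace_subalgebra
begin

context
  fixes \<rho> \<sigma>
  assumes \<rho>: "\<rho> \<in> M" "posdef \<rho>" and \<sigma>: "\<sigma> \<in> M" "posdef \<sigma>"
    and tau_one: "tau \<rho> = 1" "tau \<sigma> = 1"
begin

abbreviation "rotation t \<equiv> 1/2 + \<i> * complex_of_real t"

definition petz_sqrt :: "real \<Rightarrow> 'n cmat" where
  "petz_sqrt t = mpow (E \<sigma>) (rotation t) ** mpow (E \<rho>) (- rotation t) ** mpow \<rho> (rotation t)"

lemma petz_sqrt_in: "petz_sqrt t \<in> M"
  unfolding petz_sqrt_def using E_\<rho>[OF \<rho> \<sigma>] E_\<sigma>[OF \<rho> \<sigma>] \<rho> by auto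

lemma adj_petz_sqrt: "adj (petz_sqrt t) ** petz_sqrt t = petz_rot E \<rho> t (E \<sigma>)"
proof -
  note E = E_\<rho>[OF \<rho> \<sigma>] E_\<sigma>[OF \<rho> \<sigma>]
  have s: "mpow (E \<sigma>) (cnj (rotation t)) ** mpow (E \<sigma>) (rotation t) = E \<sigma>"
    using E by (simp add: mpow_add mpow_1)
  have "adj (petz_sqrt t) ** petz_sqrt t = mpow \<rho> (cnj (rotation t)) ** mpow (E \<rho>) (- cnj (rotation t)) **
      (mpow (E \<sigma>) (cnj (rotation t)) ** mpow (E \<sigma>) (rotation t)) **
      mpow (E \<rho>) (- rotation t) ** mpow \<rho> (rotation t)"
    using E \<rho> by (simp add: petz_sqrt_def adj_mult adj_mpow matrix_mul_assoc)
  then show ?thesis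
    unfolding s petz_rot_def by simp
qed

lemma petz_rot_in: "petz_rot E \<rho> t (E \<sigma>) \<in> M"
  using petz_sqrt_in by (simp flip: adj_petz_sqrt)

lemma adj_petz_rot: "adj (petz_rot E \<rho> t (E \<sigma>)) = petz_rot E \<rho> t (E \<sigma>)"
  by (simp add: adj_mult flip: adj_petz_sqrt)

text \<open>Supplies the normalization \<open>hs_norm (petz_sqrt t) = 1\<close> for the
  difference-of-squares estimate.\<close>

lemma tau_petz_rot: "tau (petz_rot E \<rho> t (E \<sigma>)) = 1"
proof -
  note E = E_\<rho>[OF \<rho> \<sigma>] E_\<sigma>[OF \<rho> \<sigma>]
  define a where "a = mpow (E \<rho>) (-1/2 + \<i> * of_real t)"
  define b where "b = mpow (E \<rho>) (-1/2 - \<i> * of_real t)"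
  define r where "r = mpow \<rho> (1/2 - \<i> * of_real t)"
  define r' where "r' = mpow \<rho> (1/2 + \<i> * of_real t)"
  have in': "a \<in> N" "b \<in> N" "r \<in> M" "r' \<in> M"
    using E \<rho> by (auto simp: a_def b_def r_def r'_def)
  have "tau (petz_rot E \<rho> t (E \<sigma>)) = tau (r ** (a ** E \<sigma> ** b) ** r')"
    by (simp add: petz_rot_def a_def b_def r_def r'_def matrix_mul_assoc)
  also have "\<dots> = tau ((a ** E \<sigma> ** b) ** r' ** r)"
    using in' E by (intro tau_cycle[symmetric]) auto
  also have "(a ** E \<sigma> ** b) ** r' ** r = (a ** E \<sigma> ** b) ** \<rho>"
    using \<rho> by (simp add: r_def r'_def mpow_add mpow_1 flip: matrix_mul_assoc)
  \<comment> \<open>The two outer powers have merged into \<open>\<rho>\<close>, and all that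
    remains beside it lies in \<open>N\<close>.\<close>
  also have "tau \<dots> = tau ((a ** E \<sigma> ** b) ** E \<rho>)"
    using in' E \<rho> by (intro tau_E[symmetric]) auto
  also have "\<dots> = tau (a ** (E \<sigma> ** (b ** E \<rho>)))" by (simp add: matrix_mul_assoc)
  also have "\<dots> = tau ((E \<sigma> ** (b ** E \<rho>)) ** a)"
    using in' E by (intro tau_commute) auto
  also have "b ** E \<rho> = mpow (E \<rho>) (1/2 - \<i> * of_real t)"
    using mpow_add[OF E(2), of "-1/2 - \<i> * of_real t" 1] E by (simp add: b_def mpow_1)
  also have "(E \<sigma> ** \<dots>) ** a = E \<sigma>"
    using E by (simp add: a_def mpow_add mpow_0 flip: matrix_mul_assoc)
  finally show ?thesis using tau_one \<sigma> by (simp add: tau_E_one)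
qed

text \<open>Right multiplication by the complex power of \<open>\<rho>\<close> maps the modular
  vector to X - Y. That power times its adjoint is \<open>\<rho>\<close>, so the phase leaves the
  norm unaffected.\<close>

lemma hs_norm_petz_sqrt_diff:
  "hs_norm (mpow \<sigma> (rotation t) - petz_sqrt t) = gns_norm \<rho> (modular_diff \<rho> \<sigma> t)"
proof -
  note E = E_\<rho>[OF \<rho> \<sigma>] E_\<sigma>[OF \<rho> \<sigma>]
  let ?W = "modular_diff \<rho> \<sigma> t" and ?r = "mpow \<rho> (rotation t)"
  have W: "?W = mpow \<sigma> (rotation t) ** mpow \<rho> (- rotation t) -
      mpow (E \<sigma>) (rotation t) ** mpow (E \<rho>) (- rotation t)"
    unfolding modular_diff_def[OF \<rho> \<sigma>] bifun_powr[OF \<sigma>(2) \<rho>(2)] bifun_powr[OF E(5,2)] ..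
  have WM: "?W \<in> M" by (rule modular_diff_in[OF \<rho> \<sigma>])
  have "?W ** ?r = mpow \<sigma> (rotation t) - petz_sqrt t"
    unfolding W matmul_diff_left petz_sqrt_def
    using mpow_add[OF \<rho>(2), of "- rotation t" "rotation t"] \<rho>
    by (simp add: mpow_0 flip: matrix_mul_assoc)
  moreover have "tau (adj (?W ** ?r) ** (?W ** ?r)) = tau (adj ?W ** ?W ** \<rho>)"
  proof -
    have "tau (adj (?W ** ?r) ** (?W ** ?r)) = tau (adj ?r ** (adj ?W ** ?W) ** ?r)"
      by (simp add: adj_mult matrix_mul_assoc)
    also have "\<dots> = tau ((adj ?W ** ?W) ** ?r ** adj ?r)"
      using WM \<rho> by (intro tau_cycle[symmetric]) auto
    also have "?r ** adj ?r = \<rho>" using \<rho> by (simp add: adj_mpow mpow_add mpow_1)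
    then have "(adj ?W ** ?W) ** ?r ** adj ?r = adj ?W ** ?W ** \<rho>"
      by (simp flip: matrix_mul_assoc)
    finally show ?thesis .
  qed
  ultimately show ?thesis
    unfolding gns_norm_def hs_norm_def gns_form_eq[OF \<rho> WM WM, symmetric] by simp
qed

lemma tau_unitary_petz_rot_le:
  assumes S: "S \<in> M" "adj S ** S = mat 1"
  shows "cmod (tau (S ** (\<sigma> - petz_rot E \<rho> t (E \<sigma>)))) \<le> 2 * gns_norm \<rho> (modular_diff \<rho> \<sigma> t)"
proof -
  let ?X = "mpow \<sigma> (rotation t)"
  have X: "?X \<in> M" "adj ?X ** ?X = \<sigma>"
    using \<sigma> by (auto simp: adj_mpow mpow_add mpow_1)
  have "hs_norm ?X = 1" "hs_norm (petz_sqrt t) = 1"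
    by (simp_all add: hs_norm_def X adj_petz_sqrt tau_petz_rot tau_one)
  from tau_unitary_square_diff_le[OF X(1) petz_sqrt_in S this]
  show ?thesis unfolding X(2) adj_petz_sqrt hs_norm_petz_sqrt_diff .
qed

text \<open>Pairing the identity with Delta 1 gives tau(sigma) = 1, so Delta 1 cannot have norm
  0.\<close>

lemma Qx2_pos: "0 < Qx2 tau \<rho> \<sigma>"
proof -
  let ?a = "\<sigma> ** mpow \<rho> (- 1)"
  have a: "?a \<in> M" using \<rho> \<sigma> by auto
  have "?a ** \<rho> = \<sigma>"
    using mpow_add[OF \<rho>(2), of "- 1" 1] \<rho> by (simp add: mpow_1 mpow_0 flip: matrix_mul_assoc)
  then have "1 \<le> gns_norm \<rho> (mat 1) * gns_norm \<rho> ?a"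
    using gns_cauchy_schwarz[OF \<rho> one_in a] tau_one by simp
  then have "gns_norm \<rho> ?a \<noteq> 0" by auto
  then show ?thesis unfolding Qx2_eq_gns_norm[OF \<sigma> \<rho>] by simp
qed

text \<open>The common length scale (Q D)^(1/4): each inequality amounts to a multiple of it
  bounding tau(S x).\<close>

definition petz_rate :: real where
  "petz_rate = root 4 (Qx2 tau \<rho> \<sigma> * (rel_ent tau \<rho> \<sigma> - rel_ent tau (E \<rho>) (E \<sigma>)))"

lemma petz_rate_nonneg: "0 \<le> petz_rate"
  and petz_rate_pow: "petz_rate ^ 4 = Qx2 tau \<rho> \<sigma> * (rel_ent tau \<rho> \<sigma> - rel_ent tau (E \<rho>) (E \<sigma>))"
  using Qx2_pos entropy_difference_nonneg[OF \<rho> \<sigma>] by (simp_all add: petz_rate_def)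

lemma tau_unitary_petz_rot_le_rate:
  assumes S: "S \<in> M" "adj S ** S = mat 1"
  shows "cmod (tau (S ** (\<sigma> - petz_rot E \<rho> t (E \<sigma>)))) \<le> 8 * cosh (pi * t) / pi * petz_rate"
proof -
  let ?n = "gns_norm \<rho> (modular_diff \<rho> \<sigma> t)"
  have "(pi / (4 * cosh (pi * t)) * ?n) ^ 4 \<le> petz_rate ^ 4"
    unfolding petz_rate_pow by (rule gns_norm_modular_diff_pow4_le[OF \<rho> \<sigma> Qx2_pos])
  then have "pi / (4 * cosh (pi * t)) * ?n \<le> petz_rate"
    using petz_rate_nonneg by (rule power_le_imp_le_base[of _ 3, simplified numeral_eq_Suc, simplified])
  then have "2 * ?n \<le> 8 * cosh (pi * t) / pi * petz_rate"
    by (simp add: field_simps)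
  then show ?thesis using tau_unitary_petz_rot_le[OF S, of t] by linarith
qed

lemma entropy_difference_ge:
  assumes x: "x \<in> M" "hermitian x" and c: "0 < c"
    and le: "\<And>S. S \<in> M \<Longrightarrow> adj S ** S = mat 1 \<Longrightarrow> c * cmod (tau (S ** x)) \<le> petz_rate"
  shows "c ^ 4 * inverse (Qx2 tau \<rho> \<sigma>) * norm1 tau x ^ 4 \<le>
    rel_ent tau \<rho> \<sigma> - rel_ent tau (E \<rho>) (E \<sigma>)"
proof -
  obtain S where S: "S \<in> M" "adj S ** S = mat 1" "norm1 tau x = Re (tau (S ** x))"
    using norm1_eq_tau_sign[OF x] .
  have "\<bar>c * norm1 tau x\<bar> \<le> c * cmod (tau (S ** x))"
    unfolding S(3) abs_mult using c by (simp add: abs_Re_le_cmod)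
  also have "\<dots> \<le> petz_rate" by (rule le[OF S(1,2)])
  finally have "\<bar>c * norm1 tau x\<bar> ^ 4 \<le> petz_rate ^ 4" by (rule power_mono) simp
  then have "c ^ 4 * norm1 tau x ^ 4 \<le>
      Qx2 tau \<rho> \<sigma> * (rel_ent tau \<rho> \<sigma> - rel_ent tau (E \<rho>) (E \<sigma>))"
    unfolding petz_rate_pow by (simp add: power_even_abs power_mult_distrib)
  then show ?thesis using Qx2_pos by (simp add: field_simps)
qed

lemma entropy_difference_ge_petz_rot:
  "(pi / (8 * cosh (pi * t))) ^ 4 * inverse (Qx2 tau \<rho> \<sigma>) * norm1 tau (\<sigma> - petz_rot E \<rho> t (E \<sigma>)) ^ 4 \<le>
    rel_ent tau \<rho> \<sigma> - rel_ent tau (E \<rho>) (E \<sigma>)"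
proof (rule entropy_difference_ge)
  show "\<sigma> - petz_rot E \<rho> t (E \<sigma>) \<in> M" using \<sigma> petz_rot_in by auto
  show "hermitian (\<sigma> - petz_rot E \<rho> t (E \<sigma>))"
    using posdef_hermitian[OF \<sigma>(2)] by (simp add: hermitian_def adj_diff adj_petz_rot)
  show "0 < pi / (8 * cosh (pi * t))" by simp
  fix S assume "S \<in> M" "adj S ** S = mat 1"
  from tau_unitary_petz_rot_le_rate[OF this, of t]
  show "pi / (8 * cosh (pi * t)) * cmod (tau (S ** (\<sigma> - petz_rot E \<rho> t (E \<sigma>)))) \<le> petz_rate"
    by (simp add: field_simps)
qed

lemma bounded_continuous_petz_rot: "bounded_continuous (\<lambda>t. petz_rot E \<rho> (t / 2) (E \<sigma>))"
proof -
  have "bounded_continuous (\<lambda>t. mpow A (of_real a + \<i> * of_real (b * t / 2)))"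
    if "posdef A" for A :: "'n cmat" and a b
    using that by (rule bounded_continuous_mpow[where a = a]) (auto intro!: continuous_intros)
  from this[OF \<rho>(2), of "1/2" "-1"] this[OF \<rho>(2), of "1/2" 1]
    this[OF E_\<rho>(2)[OF \<rho> \<sigma>], of "-1/2" 1] this[OF E_\<rho>(2)[OF \<rho> \<sigma>], of "-1/2" "-1"]
  show ?thesis
    unfolding petz_rot_def by (intro bounded_continuous_matmul bounded_continuous_const) simp_all
qed

lemma integrable_beta_dens: "integrable lborel beta_dens"
  and integral_beta_dens: "integral\<^sup>L lborel beta_dens = 1"
  using has_bochner_integral_beta_dens by (auto simp: has_bochner_integral_iff)

lemma integrable_petz_univ: "integrable lborel (\<lambda>t. beta_dens t *\<^sub>R petz_rot E \<rho> (t / 2) (E \<sigma>))"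
  by (rule integrable_scaleR_bounded_continuous[OF integrable_beta_dens beta_dens_nonneg bounded_continuous_petz_rot])

lemma diff_petz_univ:
  "\<sigma> - petz_univ E \<rho> (E \<sigma>) = (\<integral>t. beta_dens t *\<^sub>R (\<sigma> - petz_rot E \<rho> (t / 2) (E \<sigma>)) \<partial>lborel)"
  and integrable_diff_petz_univ:
  "integrable lborel (\<lambda>t. beta_dens t *\<^sub>R (\<sigma> - petz_rot E \<rho> (t / 2) (E \<sigma>)))"
proof -
  have 1: "integrable lborel (\<lambda>t. beta_dens t *\<^sub>R \<sigma>)" "(\<integral>t. beta_dens t *\<^sub>R \<sigma> \<partial>lborel) = \<sigma>"
    using integrable_beta_dens by (simp_all add: integral_beta_dens)
  show "\<sigma> - petz_univ E \<rho> (E \<sigma>) = (\<integral>t. beta_dens t *\<^sub>R (\<sigma> - petz_rot E \<rho> (t / 2) (E \<sigma>)) \<partial>lborel)"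
    unfolding scaleR_diff_right petz_univ_def
      Bochner_Integration.integral_diff[OF 1(1) integrable_petz_univ] 1(2) ..
  show "integrable lborel (\<lambda>t. beta_dens t *\<^sub>R (\<sigma> - petz_rot E \<rho> (t / 2) (E \<sigma>)))"
    unfolding scaleR_diff_right by (rule Bochner_Integration.integrable_diff[OF 1(1) integrable_petz_univ])
qed

text \<open>The unitary \<open>S\<close> is fixed before averaging, so the bound for each rotation
  integrates as a scalar inequality.\<close>

lemma entropy_difference_ge_petz_univ:
  "(1 / 4) ^ 4 * inverse (Qx2 tau \<rho> \<sigma>) * norm1 tau (\<sigma> - petz_univ E \<rho> (E \<sigma>)) ^ 4 \<le>
    rel_ent tau \<rho> \<sigma> - rel_ent tau (E \<rho>) (E \<sigma>)"
proof (rule entropy_difference_ge)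
  let ?f = "\<lambda>t. beta_dens t *\<^sub>R (\<sigma> - petz_rot E \<rho> (t / 2) (E \<sigma>))"
  have dM: "\<sigma> - petz_rot E \<rho> (t / 2) (E \<sigma>) \<in> M" for t
    using \<sigma> petz_rot_in by auto
  then have fM: "?f t \<in> M" for t
    by (simp flip: cscale_of_real)
  show "\<sigma> - petz_univ E \<rho> (E \<sigma>) \<in> M"
    unfolding diff_petz_univ by (rule integral_in[OF integrable_diff_petz_univ fM])
  have "adj (?f t) = ?f t" for t
    using posdef_hermitian[OF \<sigma>(2)] by (simp add: hermitian_def adj_scaleR adj_diff adj_petz_rot)
  then show "hermitian (\<sigma> - petz_univ E \<rho> (E \<sigma>))"
    unfolding hermitian_def diff_petz_univ
    using integral_bounded_linear[OF bounded_linear_adj integrable_diff_petz_univ] by simp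
  show "0 < (1 / 4 :: real)" by simp
  fix S assume S: "S \<in> M" "adj S ** S = mat 1"
  \<comment> \<open>The pointwise constant 8 / pi meets the mean pi / 2 of the hyperbolic cosine,
    leaving 4.\<close>
  have bound: "integrable lborel (\<lambda>t. beta_dens t * cosh (pi * (t / 2)) * (8 / pi * petz_rate))"
    "(\<integral>t. beta_dens t * cosh (pi * (t / 2)) * (8 / pi * petz_rate) \<partial>lborel) = 4 * petz_rate"
    using has_bochner_integral_mult_left[OF has_bochner_integral_beta_dens_cosh, of "8 / pi * petz_rate"]
    by (auto simp: has_bochner_integral_iff)
  have "cmod (tau (S ** (\<sigma> - petz_univ E \<rho> (E \<sigma>)))) = cmod (\<integral>t. tau (S ** ?f t) \<partial>lborel)"
    unfolding diff_petz_univ tau_integral(2)[OF integrable_diff_petz_univ fM S(1)] ..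
  also have "\<dots> \<le> (\<integral>t. beta_dens t * cosh (pi * (t / 2)) * (8 / pi * petz_rate) \<partial>lborel)"
  proof (rule Bochner_Integration.integral_norm_bound_integral)
    show "integrable lborel (\<lambda>t. tau (S ** ?f t))"
      by (rule tau_integral(1)[OF integrable_diff_petz_univ fM S(1)])
    show "integrable lborel (\<lambda>t. beta_dens t * cosh (pi * (t / 2)) * (8 / pi * petz_rate))"
      by (rule bound(1))
    fix t :: real
    have "tau (S ** ?f t) = of_real (beta_dens t) * tau (S ** (\<sigma> - petz_rot E \<rho> (t / 2) (E \<sigma>)))"
      using S dM by (simp add: tau_cscale flip: cscale_of_real)
    then have "cmod (tau (S ** ?f t)) =
        beta_dens t * cmod (tau (S ** (\<sigma> - petz_rot E \<rho> (t / 2) (E \<sigma>))))"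
      by (simp add: norm_mult beta_dens_nonneg)
    also have "\<dots> \<le> beta_dens t * (8 * cosh (pi * (t / 2)) / pi * petz_rate)"
      by (intro mult_left_mono tau_unitary_petz_rot_le_rate[OF S] beta_dens_nonneg)
    finally show "cmod (tau (S ** ?f t)) \<le> beta_dens t * cosh (pi * (t / 2)) * (8 / pi * petz_rate)"
      by (simp add: mult_ac)
  qed
  finally show "1 / 4 * cmod (tau (S ** (\<sigma> - petz_univ E \<rho> (E \<sigma>)))) \<le> petz_rate"
    unfolding bound(2) by simp
qed

end

end

theorem theorem4p5:
  fixes M N :: "'n::finite cmat set"
    and tau :: "'n cmat \<Rightarrow> complex"
    and E :: "'n cmat \<Rightarrow> 'n cmat"
    and \<rho> \<sigma> :: "'n cmat"
    and t :: real
  assumes "star_subalg M" and "star_subalg N" and "N \<subseteq> M"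
    and "faithful_trace M tau"
    and "cond_exp M N tau E"
    and "faithful_state M tau \<rho>" and "faithful_state M tau \<sigma>"
  shows "rel_ent tau \<rho> \<sigma> - rel_ent tau (E \<rho>) (E \<sigma>)
           \<ge> (pi / 8) ^ 4 * inverse (Qx2 tau \<rho> \<sigma>) * norm1 tau (\<sigma> - petz E \<rho> (E \<sigma>)) ^ 4
     \<and> rel_ent tau \<rho> \<sigma> - rel_ent tau (E \<rho>) (E \<sigma>)
           \<ge> (pi / (8 * cosh (pi * t))) ^ 4 * inverse (Qx2 tau \<rho> \<sigma>)
               * norm1 tau (\<sigma> - petz_rot E \<rho> t (E \<sigma>)) ^ 4
     \<and> rel_ent tau \<rho> \<sigma> - rel_ent tau (E \<rho>) (E \<sigma>)
           \<ge> 1 / 256 * inverse (Qx2 tau \<rho> \<sigma>) * norm1 tau (\<sigma> - petz_univ E \<rho> (E \<sigma>)) ^ 4"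
proof -
  interpret trace_subalgebra M tau N E
    by unfold_locales (rule assms)+
  have \<rho>: "\<rho> \<in> M" "posdef \<rho>" and \<sigma>: "\<sigma> \<in> M" "posdef \<sigma>"
    and tau_one: "tau \<rho> = 1" "tau \<sigma> = 1"
    using assms(6,7) by (auto simp: faithful_state_def is_state_def intro: psd_invertible_imp_posdef)
  note rot = entropy_difference_ge_petz_rot[OF \<rho> \<sigma> tau_one]
  \<comment> \<open>The unrotated Petz map is the rotated one at parameter 0, where cosh equals
    1.\<close>
  show ?thesis
    using rot[of 0] rot[of t] entropy_difference_ge_petz_univ[OF \<rho> \<sigma> tau_one]
    by (simp add: petz_def power_divide)
qed

end
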